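(* Let $\zeta:\mathbb{C}\to\widehat{\mathbb{C}}$ be the Riemann zeta function, and let $\nu_\zeta:\mathbb{C}\to\widehat{\mathbb{C}}$ be the meromorphic function $\nu_\zeta(z):=z-\dfrac{\zeta(z)}{z\,\zeta'(z)}$. The following conditions (a)–(e) are equivalent: (a) The Riemann hypothesis holds (every non-trivial zero of $\zeta$ lies on the line $\{s\in\mathbb{C}:\operatorname{Re}s=1/2\}$) and every non-trivial zero of $\zeta$ is simple. (b) Every non-trivial zero of $\zeta$ is an indifferent fixed point of $\nu_\zeta$. (c) The function $\nu_\zeta$ has no attracting fixed point. (d) There is no topological disk $D\subset\mathbb{C}$ with $\overline{\nu_\zeta(D)}\subset D$. (e) For any homeomorphism $h:\widehat{\mathbb{C}}\to\widehat{\mathbb{C}}$ with $h(\infty)=\infty$, the continuous function $\nu_{\zeta,h}:=h\circ\nu_\zeta\circ h^{-1}:\mathbb{C}\to\widehat{\mathbb{C}}$ has no topological disk $D\subset\mathbb{C}$ with $\overline{\nu_{\zeta,h}(D)}\subset D$.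
   Context: $\widehat{\mathbb{C}}=\mathbb{C}\cup\{\infty\}$ is the Riemann sphere; a meromorphic function on $\mathbb{C}$ is regarded as a holomorphic map $\mathbb{C}\to\widehat{\mathbb{C}}$, so quotients such as $\zeta(z)/(z\zeta'(z))$ are taken as meromorphic functions (removable singularities are filled in). The Riemann zeta function $\zeta$ is the meromorphic continuation to $\mathbb{C}$ of $\sum_{n\ge1}n^{-s}$ ($\operatorname{Re}s>1$). Its trivial zeros are $-2,-4,-6,\dots$; all other zeros are called non-trivial. For a meromorphic function $f$ on $\mathbb{C}$, a point $\alpha\in\mathbb{C}$ with $f(\alpha)=\alpha$ is a fixed point, with multiplier $f'(\alpha)$; it is attracting if $|f'(\alpha)|<1$, indifferent if $|f'(\alpha)|=1$, and repelling if $|f'(\alpha)|>1$. A topological disk is an open subset of $\mathbb{C}$ homeomorphic to the open unit disk; closures are taken in $\widehat{\mathbb{C}}$. *)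

theory Defs
  imports "HOL-Complex_Analysis.Complex_Analysis"
begin

text \<open>
  The Riemann sphere is the one-point compactification of the complex plane: \<^term>\<open>Some z\<close> is
  the finite point \<open>z\<close> and \<^term>\<open>None\<close> is the point at infinity.
\<close>

abbreviation riemann_sphere :: "complex option topology" where
  "riemann_sphere \<equiv> Alexandroff_compactification euclidean"

text \<open>
  A meromorphic function as a map into the sphere. The value of \<open>f\<close> itself at an isolated
  singularity is irrelevant: poles go to infinity and removable singularities are filled in.
\<close>

definition sphere_map :: "(complex \<Rightarrow> complex) \<Rightarrow> complex \<Rightarrow> complex option" where
  "sphere_map f z = (if is_pole f z then None else Some (remove_sings f z))"

text \<open>
  \<^const>\<open>nicely_meromorphic_on\<close> makes the continuation unique as a function: it has no removable
  singularities and takes the dummy value 0 at poles. In particular \<open>riemann_zeta 1 = 0\<close>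
  although 1 is a pole, so that zeros have to be read off from \<open>sphere_map riemann_zeta\<close>.
\<close>

definition riemann_zeta :: "complex \<Rightarrow> complex" where
  "riemann_zeta = (THE f. f nicely_meromorphic_on UNIV \<and>
     (\<forall>s. Re s > 1 \<longrightarrow> (\<lambda>n. of_nat (Suc n) powr (- s)) sums f s))"

definition trivial_zeta_zero :: "complex \<Rightarrow> bool" where
  "trivial_zeta_zero s \<longleftrightarrow> (\<exists>n::nat. n \<ge> 1 \<and> s = - 2 * of_nat n)"

definition nontrivial_zeta_zero :: "complex \<Rightarrow> bool" where
  "nontrivial_zeta_zero s \<longleftrightarrow> sphere_map riemann_zeta s = Some 0 \<and> \<not> trivial_zeta_zero s"

definition nu_zeta :: "complex \<Rightarrow> complex option" where
  "nu_zeta = sphere_map (\<lambda>z. z - riemann_zeta z / (z * deriv riemann_zeta z))"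

definition fixed_point :: "(complex \<Rightarrow> complex option) \<Rightarrow> complex \<Rightarrow> bool" where
  "fixed_point F \<alpha> \<longleftrightarrow> F \<alpha> = Some \<alpha>"

text \<open>
  A continuous \<open>F\<close> is finite near a fixed point, so \<open>the \<circ> F\<close> is there the
  complex-valued function that \<open>F\<close> represents.
\<close>

definition multiplier :: "(complex \<Rightarrow> complex option) \<Rightarrow> complex \<Rightarrow> complex" where
  "multiplier F \<alpha> = deriv (\<lambda>z. the (F z)) \<alpha>"

definition attracting_fixed_point :: "(complex \<Rightarrow> complex option) \<Rightarrow> complex \<Rightarrow> bool" where
  "attracting_fixed_point F \<alpha> \<longleftrightarrow> fixed_point F \<alpha> \<and> norm (multiplier F \<alpha>) < 1"

definition indifferent_fixed_point :: "(complex \<Rightarrow> complex option) \<Rightarrow> complex \<Rightarrow> bool" where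
  "indifferent_fixed_point F \<alpha> \<longleftrightarrow> fixed_point F \<alpha> \<and> norm (multiplier F \<alpha>) = 1"

definition topological_disk :: "complex set \<Rightarrow> bool" where
  "topological_disk D \<longleftrightarrow> open D \<and> D homeomorphic ball (0::complex) 1"

definition maps_closure_into :: "(complex \<Rightarrow> complex option) \<Rightarrow> complex set \<Rightarrow> bool" where
  "maps_closure_into F D \<longleftrightarrow> riemann_sphere closure_of (F ` D) \<subseteq> Some ` D"

definition sphere_homeo_fixing_infinity :: "(complex option \<Rightarrow> complex option) \<Rightarrow> bool" where
  "sphere_homeo_fixing_infinity h \<longleftrightarrow>
     homeomorphic_map riemann_sphere riemann_sphere h \<and> h None = None"

text \<open>
  \<open>h \<circ> F \<circ> h\<^sup>-\<^sup>1\<close> on the plane. As \<open>h\<close> is to be a bijection of the sphere fixing infinity,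
  \<open>inv h\<close> maps finite points to finite points, so \<^const>\<open>the\<close> is applied to proper values only.
\<close>

definition sphere_conjugate ::
  "(complex option \<Rightarrow> complex option) \<Rightarrow> (complex \<Rightarrow> complex option) \<Rightarrow> complex \<Rightarrow> complex option"
  where "sphere_conjugate h F z = h (F (the (inv h (Some z))))"

end

theory Submission
  imports Defs
begin

text \<open>
  If \<open>f\<close> has order \<open>m \<noteq> 0\<close> at \<open>\<alpha> \<noteq> 0\<close>, then \<open>z - f(z) / (z f'(z))\<close> fixes \<open>\<alpha>\<close> with multiplier
  \<open>1 - 1/(m \<alpha>)\<close>. The fixed points of \<open>\<nu>\<^sub>\<zeta>\<close> are the zeros of \<open>\<zeta>\<close> and the pole 1 (where \<open>m < 0\<close>), so the
  attracting ones are exactly the non-trivial zeros with \<open>m Re \<alpha> > 1/2\<close>, and the functional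
  equation, which pairs \<open>\<alpha>\<close> with \<open>1 - \<alpha>\<close>, turns \<open>m Re \<alpha> \<le> 1/2\<close> for all of them into \<open>m = 1\<close> and
  \<open>Re \<alpha> = 1/2\<close>. A disk that is mapped relatively compactly into itself contains an attracting fixed
  point by the Riemann mapping theorem, Brouwer's theorem and the Schwarz lemma; the existence of
  such a disk is invariant under conjugation.

  The functional equation is obtained on the real interval \<open>-1 < s < 0\<close> and extended by analytic
  continuation. With \<open>P(x) = {x} (1 - {x}) / 2\<close> the trapezoidal rule gives
  \<open>\<zeta>(s) = s (s + 1) \<integral>\<^sub>0\<^sup>\<infinity> P(x) x\<^sup>-\<^sup>s\<^sup>-\<^sup>2 dx\<close> there. Writing \<open>\<Gamma>(s + 2) x\<^sup>-\<^sup>s\<^sup>-\<^sup>2\<close> as a Laplace integral and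
  exchanging turns this into a Mellin integral of \<open>1/(e\<^sup>t - 1) - 1/t + 1/2 = \<Sum>\<^sub>k 2t/(t\<^sup>2 + 4\<pi>\<^sup>2k\<^sup>2)\<close>. All
  integrands are non-negative, so Tonelli's theorem justifies every exchange.
\<close>

section \<open>Continuation of the zeta series to \<open>Re s > -1\<close>\<close>

text \<open>Two integrations by parts: the kernel \<open>(x - a) * (a + 1 - x) / 2\<close> vanishes
  at both ends, has slope 1/2 and -1/2 there, and has second derivative -1. The Banach-valued form
  serves complex powers in \<open>zeta_term_has_integral\<close> and real exponentials in
  \<open>exp_kernel_has_integral\<close>.\<close>

lemma trapezoid_error_has_integral:
  fixes \<phi> \<Phi> \<phi>' \<phi>'' :: "real \<Rightarrow> 'a::banach"
  assumes "\<And>x. x \<in> {a..a+1} \<Longrightarrow> (\<Phi> has_vector_derivative \<phi> x) (at x within {a..a+1})"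
    and "\<And>x. x \<in> {a..a+1} \<Longrightarrow> (\<phi> has_vector_derivative \<phi>' x) (at x within {a..a+1})"
    and "\<And>x. x \<in> {a..a+1} \<Longrightarrow> (\<phi>' has_vector_derivative \<phi>'' x) (at x within {a..a+1})"
  shows "((\<lambda>x. ((x - a) * (a + 1 - x) / 2) *\<^sub>R \<phi>'' x) has_integral
           ((1/2) *\<^sub>R (\<phi> a + \<phi> (a+1)) - (\<Phi> (a+1) - \<Phi> a))) {a..a+1}"
proof -
  define F where "F x = ((x - a) * (a + 1 - x) / 2) *\<^sub>R \<phi>' x - (a + 1/2 - x) *\<^sub>R \<phi> x - \<Phi> x" for x
  have "(F has_vector_derivative ((x - a) * (a + 1 - x) / 2) *\<^sub>R \<phi>'' x) (at x within {a..a+1})"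
    if x: "x \<in> {a..a+1}" for x
  proof -
    have q: "((\<lambda>x. (x - a) * (a + 1 - x) / 2) has_field_derivative (a + 1/2 - x)) (at x within {a..a+1})"
      by (auto intro!: derivative_eq_intros simp: field_simps)
    have l: "((\<lambda>x. a + 1/2 - x) has_field_derivative (-1)) (at x within {a..a+1})"
      by (auto intro!: derivative_eq_intros)
    have "(F has_vector_derivative
        (((x - a) * (a + 1 - x) / 2) *\<^sub>R \<phi>'' x + (a + 1/2 - x) *\<^sub>R \<phi>' x)
        - ((a + 1/2 - x) *\<^sub>R \<phi>' x + (-1) *\<^sub>R \<phi> x) - \<phi> x) (at x within {a..a+1})"
      unfolding F_def
      by (intro has_vector_derivative_diff has_vector_derivative_scaleR q l assms x)
    then show ?thesis by simp
  qed
  then have "((\<lambda>x. ((x - a) * (a + 1 - x) / 2) *\<^sub>R \<phi>'' x) has_integral F (a+1) - F a) {a..a+1}"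
    by (intro fundamental_theorem_of_calculus) auto
  moreover have "F (a+1) - F a = (1/2) *\<^sub>R (\<phi> a + \<phi> (a+1)) - (\<Phi> (a+1) - \<Phi> a)"
    by (simp add: F_def algebra_simps)
  ultimately show ?thesis by simp
qed

text \<open>This is \<open>s - 1\<close> times the error of the trapezoidal rule for the integral of
  \<open>x powr (-s)\<close> over \<open>[n, n+1]\<close>. The factor cancels the denominator
  \<open>1 - s\<close> of the antiderivative, so that \<open>s = 1\<close> is no exception.\<close>

definition zeta_term :: "nat \<Rightarrow> complex \<Rightarrow> complex" where
  "zeta_term n s = (s - 1) / 2 * (of_nat n powr (-s) + of_nat (Suc n) powr (-s))
     + (of_nat (Suc n) powr (1 - s) - of_nat n powr (1 - s))"

text \<open>The trapezoidal rule is applied to \<open>(s - 1) * x powr (-s)\<close> with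
  antiderivative \<open>- (x powr (1 - s))\<close>. With \<open>n \<ge> 1\<close> the interval
  avoids the branch point 0.\<close>

lemma zeta_term_has_integral:
  assumes "n \<ge> 1"
  shows "((\<lambda>x. ((x - real n) * (real n + 1 - x) / 2) *\<^sub>R ((s - 1) * s * (s + 1) * of_real x powr (-s-2)))
           has_integral zeta_term n s) {real n..real n + 1}"
proof -
  have d: "((\<lambda>x. of_real x powr c) has_vector_derivative c * of_real x powr (c-1)) (at x within {real n..real n+1})"
    if "x \<in> {real n..real n+1}" for x and c :: complex
    using assms that
    by (intro has_vector_derivative_real_field) (auto intro!: derivative_eq_intros simp: complex_nonpos_Reals_iff)
  have "((\<lambda>x. ((x - real n) * (real n + 1 - x) / 2) *\<^sub>R ((s - 1) * ((-s) * ((-s - 1) * of_real x powr (-s-1-1)))))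
           has_integral ((1/2) *\<^sub>R ((s-1) * of_real (real n) powr (-s) + (s - 1) * of_real (real n + 1) powr (-s))
     - ((-1) * of_real (real n + 1) powr (1 - s) - (-1) * of_real (real n) powr (1 - s)))) {real n..real n + 1}"
    apply (rule trapezoid_error_has_integral[where \<phi>' = "\<lambda>x. (s - 1) * ((-s) * of_real x powr (-s-1))"])
      subgoal for x
        by (rule has_vector_derivative_eq_rhs, rule has_vector_derivative_mult_right[OF d]) (auto simp: algebra_simps)
      by (intro has_vector_derivative_mult_right d; assumption)+
  then show ?thesis
    by (simp add: zeta_term_def algebra_simps scaleR_conv_of_real add_divide_distrib diff_divide_distrib)
qed

text \<open>Two differentiations gain a factor of order \<open>n powr (-2)\<close> over the terms of
  the zeta series, which moves the abscissa of convergence from 1 to -1. The quadratic kernel is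
  simply bounded by 1.\<close>

lemma norm_zeta_term_le:
  assumes "n \<ge> 1" "Re s > -2"
  shows "norm (zeta_term n s) \<le> norm (s - 1) * norm s * norm (s + 1) * real n powr (- Re s - 2)"
proof -
  let ?C = "norm (s - 1) * norm s * norm (s + 1)"
  have "norm (zeta_term n s) \<le> ?C * real n powr (- Re s - 2) * measure lborel (cbox (real n) (real n + 1))"
  proof (rule has_integral_bound)
    show "((\<lambda>x. ((x - real n) * (real n + 1 - x) / 2) *\<^sub>R ((s - 1) * s * (s + 1) * of_real x powr (-s-2)))
           has_integral zeta_term n s) (cbox (real n) (real n + 1))"
      using zeta_term_has_integral[OF assms(1)] by simp
    fix x assume "x \<in> cbox (real n) (real n + 1)"
    then have x: "real n \<le> x" "x \<le> real n + 1" by auto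
    have x0: "x > 0" using x assms by linarith
    have "(x - real n) * (real n + 1 - x) \<le> 1 * 1" using x by (intro mult_mono) auto
    moreover have "(x - real n) * (real n + 1 - x) \<ge> 0" using x by (intro mult_nonneg_nonneg) auto
    ultimately have q: "\<bar>(x - real n) * (real n + 1 - x) / 2\<bar> \<le> 1" by linarith
    have "norm (of_real x powr (-s-2) :: complex) = x powr (- Re s - 2)"
      using x0 by (simp add: norm_powr_real_powr)
    also have "\<dots> \<le> real n powr (- Re s - 2)"
      using x assms x0 by (intro powr_mono2') auto
    finally have p: "norm (of_real x powr (-s-2) :: complex) \<le> real n powr (- Re s - 2)" .
    have "\<bar>(x - real n) * (real n + 1 - x) / 2\<bar> * (?C * norm (of_real x powr (-s-2) :: complex))
        \<le> 1 * (?C * real n powr (- Re s - 2))"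
      by (intro mult_mono q mult_nonneg_nonneg p order_refl norm_ge_zero) auto
    then show "norm (((x - real n) * (real n + 1 - x) / 2) *\<^sub>R ((s - 1) * s * (s + 1) * of_real x powr (-s-2)))
       \<le> ?C * real n powr (- Re s - 2)"
      by (simp add: norm_mult mult.assoc)
  qed auto
  then show ?thesis by simp
qed

text \<open>The function \<open>(s - 1) \<zeta>(s)\<close> on \<open>Re s > -1\<close>, by the trapezoidal rule for the defining series.\<close>

definition zeta_num :: "complex \<Rightarrow> complex" where
  "zeta_num s = (s - 1) / 2 + 1 + (\<Sum>n. zeta_term (Suc n) s)"

lemma summable_Suc_powr: "c < -1 \<Longrightarrow> summable (\<lambda>n. real (Suc n) powr c)"
  using summable_Suc_iff[of "\<lambda>n. real n powr c"] by (simp add: summable_real_powr_iff)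

lemma summable_zeta_term:
  assumes "Re s > -1"
  shows "summable (\<lambda>n. zeta_term (Suc n) s)"
proof (rule summable_comparison_test')
  show "summable (\<lambda>n. norm (s - 1) * norm s * norm (s + 1) * real (Suc n) powr (- Re s - 2))"
    by (intro summable_mult summable_Suc_powr) (use assms in auto)
qed (use norm_zeta_term_le[of "Suc _" s] assms in auto)

lemma zeta_num_holomorphic: "zeta_num holomorphic_on {s. Re s > -1}"
proof -
  define S where "S = {s::complex. Re s > -1}"
  have S: "open S" by (simp add: S_def open_halfspace_Re_gt)
  have "(\<lambda>s. \<Sum>n. zeta_term (Suc n) s) holomorphic_on S"
  proof (rule holomorphic_uniform_sequence[OF S, of "\<lambda>N s. \<Sum>n<N. zeta_term (Suc n) s"])
    show "(\<lambda>s. \<Sum>n<N. zeta_term (Suc n) s) holomorphic_on S" for N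
      unfolding zeta_term_def by (intro holomorphic_intros) auto
    fix x assume "x \<in> S"
    then obtain d where d: "d > 0" "cball x d \<subseteq> S" using S open_contains_cball by blast
    \<comment> \<open>The real part of the leftmost point of the closed ball. It exceeds -1 because
      that point lies in \<open>S\<close>, so \<open>real (Suc n) powr (- r - 2)\<close> is a
      summable majorant on the whole ball.\<close>
    define r where "r = (Re x - d)"
    have r: "r > -1" using d(2) d(1) 
    proof -
      have "x - of_real d \<in> cball x d" using d(1) by (simp add: dist_norm)
      then have "x - of_real d \<in> S" using d(2) by blast
      then show ?thesis by (simp add: S_def r_def)
    qed
    define M where "M = (norm x + d + 1) ^ 3"
    have "uniform_limit (cball x d) (\<lambda>N s. \<Sum>n<N. zeta_term (Suc n) s) (\<lambda>s. \<Sum>n. zeta_term (Suc n) s) sequentially"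
    proof (rule Weierstrass_m_test)
      show "summable (\<lambda>n. M * real (Suc n) powr (- r - 2))"
        by (intro summable_mult summable_Suc_powr) (use r in auto)
      fix n s assume s: "s \<in> cball x d"
      then have sS: "Re s > -1" using d(2) by (auto simp: S_def)
      have rs: "Re s \<ge> r"
        using s abs_Re_le_cmod[of "x - s"] by (auto simp: r_def dist_norm)
      have ns: "norm s \<le> norm x + d"
        using s norm_triangle_ineq2[of s x] by (auto simp: dist_norm norm_minus_commute)
      have "norm (zeta_term (Suc n) s) \<le> norm (s - 1) * norm s * norm (s + 1) * real (Suc n) powr (- Re s - 2)"
        using sS by (intro norm_zeta_term_le) auto
      also have "\<dots> \<le> ((norm x + d + 1) * (norm x + d + 1) * (norm x + d + 1)) * real (Suc n) powr (- r - 2)"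
        using ns norm_triangle_ineq4[of s 1] norm_triangle_ineq[of s 1] rs d(1)
        by (intro mult_mono powr_mono mult_nonneg_nonneg) auto
      finally show "norm (zeta_term (Suc n) s) \<le> M * real (Suc n) powr (- r - 2)"
        by (simp add: M_def power3_eq_cube)
    qed
    then show "\<exists>d>0. cball x d \<subseteq> S \<and> uniform_limit (cball x d) (\<lambda>N s. \<Sum>n<N. zeta_term (Suc n) s) (\<lambda>s. \<Sum>n. zeta_term (Suc n) s) sequentially"
      using d by blast
  qed
  then show ?thesis
    unfolding zeta_num_def S_def by (intro holomorphic_intros) auto
qed

lemma zeta_num_1 [simp]: "zeta_num 1 = 1"
  proof -
  have "zeta_term (Suc n) 1 = 0" for n
    by (simp add: zeta_term_def del: of_nat_Suc)
  then show ?thesis by (simp add: zeta_num_def)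
qed

text \<open>The powers with exponent \<open>1 - s\<close> telescope, and the averages of neighbours
  give every term full weight except the two end terms. The summand \<open>(s - 1) / 2 + 1\<close>
  on the left supplies the missing half of the first term and the lower end of the
  telescope.\<close>

lemma zeta_num_partial_sum:
  "(s - 1) / 2 + 1 + (\<Sum>n<N. zeta_term (Suc n) s) =
   (s - 1) * (\<Sum>n<N. of_nat (Suc n) powr (-s)) + (s - 1) / 2 * of_nat (Suc N) powr (-s) + of_nat (Suc N) powr (1 - s)"
proof (induction N)
  case (Suc N)
  have "(s - 1) / 2 + 1 + (\<Sum>n<Suc N. zeta_term (Suc n) s) = ((s - 1) / 2 + 1 + (\<Sum>n<N. zeta_term (Suc n) s)) + zeta_term (Suc N) s"
    by (simp add: add_ac)
  also note Suc.IH
  finally show ?case by (simp add: zeta_term_def algebra_simps add_divide_distrib diff_divide_distrib)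
qed auto

lemma tendsto_Suc_powr_0:
  assumes "Re c < 0"
  shows "(\<lambda>n. of_nat (Suc n) powr c :: complex) \<longlonglongrightarrow> 0"
proof (rule tendsto_norm_zero_cancel)
  have "(\<lambda>n. real (Suc n) powr Re c) \<longlonglongrightarrow> 0"
    using assms by (intro LIMSEQ_Suc tendsto_neg_powr filterlim_real_sequentially)
  then show "(\<lambda>n. norm (of_nat (Suc n) powr c :: complex)) \<longlonglongrightarrow> 0"
    using norm_powr_real_powr[of "of_nat (Suc _)" c] by (simp del: of_nat_Suc)
qed

text \<open>For \<open>Re s > 1\<close> both boundary terms in \<open>zeta_num_partial_sum\<close>
  tend to 0.\<close>

lemma zeta_series_sums:
  assumes "Re s > 1"
  shows "(\<lambda>n. of_nat (Suc n) powr (-s)) sums (zeta_num s / (s - 1))"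
proof -
  have s1: "s - 1 \<noteq> 0" using assms by auto
  have "(\<lambda>N. (s - 1) / 2 + 1 + (\<Sum>n<N. zeta_term (Suc n) s)) \<longlonglongrightarrow> zeta_num s"
    unfolding zeta_num_def
    by (intro tendsto_intros summable_LIMSEQ summable_zeta_term) (use assms in auto)
  moreover have "(\<lambda>N. (s - 1) / 2 * of_nat (Suc N) powr (-s) + of_nat (Suc N) powr (1 - s)) \<longlonglongrightarrow> (s-1)/2 * 0 + 0"
    by (intro tendsto_intros tendsto_Suc_powr_0) (use assms in auto)
  ultimately have "(\<lambda>N. ((s - 1) / 2 + 1 + (\<Sum>n<N. zeta_term (Suc n) s)) - ((s - 1) / 2 * of_nat (Suc N) powr (-s) + of_nat (Suc N) powr (1 - s))) \<longlonglongrightarrow> zeta_num s - ((s-1)/2 * 0 + 0)"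
    by (rule tendsto_diff)
  then have "(\<lambda>N. (s - 1) * (\<Sum>n<N. of_nat (Suc n) powr (-s))) \<longlonglongrightarrow> zeta_num s"
    unfolding zeta_num_partial_sum by simp
  then have "(\<lambda>N. (s - 1) * (\<Sum>n<N. of_nat (Suc n) powr (-s)) / (s - 1)) \<longlonglongrightarrow> zeta_num s / (s - 1)"
    using s1 by (intro tendsto_intros)
  then show ?thesis using s1 by (simp add: sums_def)
qed

section \<open>The functional equation on a real interval\<close>

text \<open>Substitute \<open>w * x powr p\<close> in Euler's integral for Gamma. The parameter
  \<open>p\<close> covers Laplace integrals (\<open>p = 1\<close>) and Gaussian integrals
  (\<open>p = 2\<close>) at once.\<close>

lemma has_integral_Gamma_powr:
  fixes a w p :: real
  assumes "a > 0" "w > 0" "p > 0"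
  shows "((\<lambda>x. x powr (p * a - 1) * exp (- w * x powr p)) has_integral (Gamma a * w powr (-a) / p)) {0<..}"
proof -
  define f :: "real \<Rightarrow> real" where "f = (\<lambda>t. t powr (a - 1) / exp t)"
  define g where "g x = w * x powr p" for x
  define g' where "g' x = w * (p * x powr (p - 1))" for x
  have "(f has_integral Gamma a) {0..}"
    using Gamma_integral_real[OF assms(1)] by (simp add: f_def)
  then have f: "(f has_integral Gamma a) {0<..}"
    by (subst has_integral_spike_set_eq[where T = "{0..}"])
       (auto intro: negligible_subset[OF negligible_sing[of 0]])
  have im: "g ` {0<..} = {0<..}"
  proof (intro equalityI subsetI)
    fix y :: real assume "y \<in> {0<..}"
    then have "y = g ((y / w) powr (1 / p))" "(y / w) powr (1 / p) \<in> {0<..}"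
      using assms by (simp_all add: g_def powr_powr)
    then show "y \<in> g ` {0<..}" by blast
  qed (use assms in \<open>auto simp: g_def\<close>)
  have inj: "inj_on g {0<..}"
  proof (rule inj_onI)
    fix x y assume "x \<in> {0<..}" "y \<in> {0<..}" "g x = g y"
    then have "x powr p = y powr p" "0 < x" "0 < y" using assms by (auto simp: g_def)
    then have "(x powr p) powr (1/p) = (y powr p) powr (1/p)" by simp
    then show "x = y" using \<open>0 < x\<close> \<open>0 < y\<close> assms by (simp add: powr_powr)
  qed
  have "f absolutely_integrable_on (g ` {0<..}) \<and> integral (g ` {0<..}) f = Gamma a"
    unfolding im
  proof
    show "f absolutely_integrable_on {0<..}"
      using has_integral_integrable[OF f] by (rule nonnegative_absolutely_integrable_1) (simp add: f_def)
    show "integral {0<..} f = Gamma a" using f by (rule integral_unique)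
  qed
  then have "(\<lambda>x. \<bar>g' x\<bar> * f (g x)) absolutely_integrable_on {0<..} \<and>
      integral {0<..} (\<lambda>x. \<bar>g' x\<bar> * f (g x)) = Gamma a"
  proof (subst has_absolute_integral_change_of_variables_1'[where g = g and g' = g'])
    fix x :: real assume "x \<in> {0<..}"
    then show "(g has_real_derivative g' x) (at x within {0<..})"
      unfolding g_def g'_def by (auto intro!: derivative_eq_intros)
  qed (use inj in auto)
  then have "((\<lambda>x. \<bar>g' x\<bar> * f (g x)) has_integral Gamma a) {0<..}"
    by (metis set_lebesgue_integral_eq_integral(1) has_integral_iff)
  \<comment> \<open>The Jacobian and the power \<open>a - 1\<close> of the substitution together
    produce the constant \<open>p * w powr a\<close>, which this factor removes.\<close>
  then have "((\<lambda>x. (w powr (-a) / p) * (\<bar>g' x\<bar> * f (g x))) has_integral (w powr (-a) / p) * Gamma a) {0<..}"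
    by (rule has_integral_mult_right)
  moreover have "(w powr (-a) / p) * (\<bar>g' x\<bar> * f (g x)) = x powr (p * a - 1) * exp (- w * x powr p)"
    if x: "x \<in> {0<..}" for x
  proof -
    have 1: "\<bar>g' x\<bar> = w * p * x powr (p - 1)" using x assms by (simp add: g'_def)
    have "f (g x) = (w * x powr p) powr (a - 1) * exp (- w * x powr p)"
      by (simp add: f_def g_def exp_minus divide_inverse)
    also have "(w * x powr p) powr (a - 1) = w powr (a - 1) * x powr (p * (a - 1))"
      using x assms by (simp add: powr_mult powr_powr)
    finally have "(w powr (-a) / p) * (\<bar>g' x\<bar> * f (g x)) =
        w powr (-a) * (w * w powr (a - 1)) * (p / p) * (x powr (p - 1) * x powr (p * (a - 1))) * exp (- w * x powr p)"
      unfolding 1 by (simp only: mult_ac times_divide_eq_right times_divide_eq_left)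
    also have "w * w powr (a - 1) = w powr a" using assms by (simp add: powr_mult_base)
    also have "x powr (p - 1) * x powr (p * (a - 1)) = x powr (p * a - 1)"
      by (simp flip: powr_add add: algebra_simps)
    also have "w powr (-a) * w powr a = 1" using assms by (simp flip: powr_add)
    finally show ?thesis using assms by simp
  qed
  ultimately have "((\<lambda>x. x powr (p * a - 1) * exp (- w * x powr p)) has_integral (w powr (-a) / p) * Gamma a) {0<..}"
    by (rule has_integral_eq[rotated])
  then show ?thesis by (simp add: mult.commute)
qed

lemma nn_integral_Gamma_powr:
  fixes a w p :: real
  assumes "a > 0" "w > 0" "p > 0"
  shows "(\<integral>\<^sup>+x. ennreal (x powr (p * a - 1) * exp (- w * x powr p)) * indicator {0<..} x \<partial>lborel)
           = ennreal (Gamma a * w powr (-a) / p)"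
  by (rule nn_integral_has_integral_lebesgue'[OF _ has_integral_Gamma_powr[OF assms]]) auto

lemma nn_integral_cmult_Gamma_powr:
  fixes a w p :: real
  assumes "a > 0" "w > 0" "p > 0"
  shows "(\<integral>\<^sup>+x. C * (ennreal (x powr (p * a - 1) * exp (- w * x powr p)) * indicator {0<..} x) \<partial>lborel)
           = C * ennreal (Gamma a * w powr (-a) / p)"
  by (subst nn_integral_cmult) (simp, subst nn_integral_Gamma_powr[OF assms], rule refl)

text \<open>Write \<open>1 / (t\<^sup>2 + c\<^sup>2)\<close> as the integral of
  \<open>exp (- w * (t\<^sup>2 + c\<^sup>2))\<close> over \<open>w > 0\<close> and exchange the
  integrals: both integrations are then Gamma integrals. The bounds on \<open>s\<close> make both
  Gamma arguments positive.\<close>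

lemma nn_integral_powr_over_quadratic:
  fixes s c :: real
  assumes s: "-1 < s" "s < 1" and c: "c > 0"
  shows "(\<integral>\<^sup>+t. ennreal (t powr s / (t\<^sup>2 + c\<^sup>2)) * indicator {0<..} t \<partial>lborel)
       = ennreal (Gamma ((1 + s) / 2) * Gamma ((1 - s) / 2) / 2 * c powr (s - 1))"
proof -
  let ?a = "(1 + s) / 2" and ?b = "(1 - s) / 2"
  have Ga: "Gamma ?a > 0" and Gb: "Gamma ?b > 0" using s by (auto intro!: Gamma_real_pos)
  define F where "F t w = ennreal (t powr s * exp (- w * (t\<^sup>2 + c\<^sup>2))) * indicator {0<..} t * indicator {0<..} w" for t w :: real
  have 1: "(\<integral>\<^sup>+w. F t w \<partial>lborel) = ennreal (t powr s / (t\<^sup>2 + c\<^sup>2)) * indicator {0<..} t" for t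
  proof -
    have pos: "t\<^sup>2 + c\<^sup>2 > 0" using c by (simp add: add_nonneg_pos)
    have "(\<integral>\<^sup>+w. F t w \<partial>lborel) = (\<integral>\<^sup>+w. (ennreal (t powr s) * indicator {0<..} t) * (ennreal (w powr (1 * 1 - 1) * exp (- (t\<^sup>2 + c\<^sup>2) * w powr 1)) * indicator {0<..} w) \<partial>lborel)"
      by (intro nn_integral_cong) (auto simp: F_def ennreal_mult' algebra_simps split: split_indicator)
    also have "\<dots> = (ennreal (t powr s) * indicator {0<..} t) * ennreal (Gamma 1 * (t\<^sup>2 + c\<^sup>2) powr (-1) / 1)"
      using pos by (intro nn_integral_cmult_Gamma_powr) auto
    also have "\<dots> = ennreal (t powr s / (t\<^sup>2 + c\<^sup>2)) * indicator {0<..} t"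
      using pos by (simp add: powr_minus divide_inverse ennreal_mult' mult_ac split: split_indicator)
    finally show ?thesis .
  qed
  \<comment> \<open>A Gaussian integral: \<open>p = 2\<close> and exponent
    \<open>2 * ?a - 1 = s\<close>. The resulting power \<open>w powr (- ?a)\<close> has exponent
    \<open>?b - 1\<close> because \<open>?a + ?b = 1\<close>, which prepares the last Gamma
    integral.\<close>
  have 2: "(\<integral>\<^sup>+t. F t w \<partial>lborel) = ennreal (Gamma ?a / 2) * (ennreal (w powr (1 * ?b - 1) * exp (- c\<^sup>2 * w powr 1)) * indicator {0<..} w)" for w
  proof (cases "w > 0")
    case True
    have "(\<integral>\<^sup>+t. F t w \<partial>lborel) = (\<integral>\<^sup>+t. ennreal (exp (- w * c\<^sup>2)) * (ennreal (t powr (2 * ?a - 1) * exp (- w * t powr 2)) * indicator {0<..} t) \<partial>lborel)"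
      using True by (intro nn_integral_cong)
        (auto simp: F_def ennreal_mult' [symmetric] algebra_simps exp_add[symmetric] exp_diff field_simps split: split_indicator)
    also have "\<dots> = ennreal (exp (- w * c\<^sup>2)) * ennreal (Gamma ?a * w powr (-?a) / 2)"
      using True s by (intro nn_integral_cmult_Gamma_powr) auto
    also have "\<dots> = ennreal (exp (- w * c\<^sup>2) * (Gamma ?a * w powr (-?a) / 2))"
      by (rule ennreal_mult'[symmetric]) simp
    also have "exp (- w * c\<^sup>2) * (Gamma ?a * w powr (-?a) / 2) = (Gamma ?a / 2) * (w powr (1 * ?b - 1) * exp (- c\<^sup>2 * w powr 1))"
    proof -
      have "- ?a = 1 * ?b - 1" by (simp add: field_simps)
      then show ?thesis using True by (simp only:) (simp add: mult_ac)
    qed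
    also have "ennreal \<dots> = ennreal (Gamma ?a / 2) * ennreal (w powr (1 * ?b - 1) * exp (- c\<^sup>2 * w powr 1))"
      using Ga by (intro ennreal_mult') auto
    finally show ?thesis using True by simp
  qed (simp add: F_def)
  have "(\<integral>\<^sup>+t. ennreal (t powr s / (t\<^sup>2 + c\<^sup>2)) * indicator {0<..} t \<partial>lborel) = (\<integral>\<^sup>+t. \<integral>\<^sup>+w. F t w \<partial>lborel \<partial>lborel)"
    by (simp add: 1)
  also have "\<dots> = (\<integral>\<^sup>+w. \<integral>\<^sup>+t. F t w \<partial>lborel \<partial>lborel)"
    by (rule lborel_pair.Fubini'[symmetric]) (simp add: F_def)
  also have "\<dots> = ennreal (Gamma ?a / 2) * ennreal (Gamma ?b * (c\<^sup>2) powr (-?b) / 1)"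
    unfolding 2 using s c by (intro nn_integral_cmult_Gamma_powr) auto
  also have "\<dots> = ennreal (Gamma ?a / 2 * (Gamma ?b * (c\<^sup>2) powr (-?b) / 1))"
    using Ga by (intro ennreal_mult'[symmetric]) auto
  also have "(c\<^sup>2) powr (-?b) = c powr (s - 1)"
  proof -
    have "(c\<^sup>2) powr (-?b) = c powr (2 * (- ?b))"
      using c by (simp add: powr_powr flip: powr_numeral del: mult_minus_right)
    also have "2 * (- ?b) = s - 1" by (simp add: field_simps)
    finally show ?thesis .
  qed
  finally show ?thesis by (simp add: mult_ac)
qed

text \<open>The logarithmic derivative of the reflection formula expresses
  \<open>Digamma z - Digamma (1 - z)\<close> by the cotangent. In the limit formulas for the two
  Digamma values the logarithms cancel, and the remaining sums give the series.\<close>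

lemma cot_partial_fractions:
  fixes z :: complex
  assumes "z \<notin> \<int>"
  shows "(\<lambda>n. 2 * z / ((of_nat (Suc n))\<^sup>2 - z\<^sup>2)) sums (1 / z - of_real pi * cot (of_real pi * z))"
proof -
  have nz: "z + of_nat n \<noteq> 0" "of_nat n - z \<noteq> 0" "of_nat n + z \<noteq> 0" for n
  proof -
    have "z \<noteq> - of_nat n" "z \<noteq> of_nat n" using assms by auto
    then show "z + of_nat n \<noteq> 0" "of_nat n - z \<noteq> 0" "of_nat n + z \<noteq> 0"
      by (auto simp: add_eq_0_iff2 add.commute)
  qed
  have nI: "z \<notin> \<int>\<^sub>\<le>\<^sub>0" "1 - z \<notin> \<int>\<^sub>\<le>\<^sub>0"
    using assms nonpos_Ints_Int Ints_diff[of 1 "1 - z"] by auto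
  have s0: "sin (of_real pi * z) \<noteq> 0"
    using assms by (auto simp: sin_eq_0)
  have Gnz: "Gamma z \<noteq> 0" "Gamma (1 - z) \<noteq> 0" using nI by (auto simp: Gamma_eq_zero_iff)
  have "((\<lambda>z. Gamma z * Gamma (1 - z)) has_field_derivative
           Gamma z * Gamma (1 - z) * (Digamma z - Digamma (1 - z))) (at z)"
    using nI by (auto intro!: derivative_eq_intros simp: algebra_simps)
  moreover have "((\<lambda>z. of_real pi / sin (of_real pi * z)) has_field_derivative
      - (of_real pi * (cos (of_real pi * z) * of_real pi)) / (sin (of_real pi * z))\<^sup>2) (at z)"
    using s0 by (auto intro!: derivative_eq_intros simp: power2_eq_square)
  ultimately have "Gamma z * Gamma (1 - z) * (Digamma z - Digamma (1 - z)) = - (of_real pi * (cos (of_real pi * z) * of_real pi)) / (sin (of_real pi * z))\<^sup>2"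
    unfolding Gamma_reflection_complex by (rule DERIV_unique)
  then have dg: "Digamma z - Digamma (1 - z) = - of_real pi * cot (of_real pi * z)"
  proof -
    define S C D where "S = sin (of_real pi * z)" and "C = cos (of_real pi * z)" and "D = Digamma z - Digamma (1 - z)"
    assume "Gamma z * Gamma (1 - z) * (Digamma z - Digamma (1 - z)) = - (of_real pi * (cos (of_real pi * z) * of_real pi)) / (sin (of_real pi * z))\<^sup>2"
    then have "of_real pi / S * D = - (of_real pi * (C * of_real pi)) / S\<^sup>2"
      unfolding Gamma_reflection_complex S_def C_def D_def .
    then have "D * S = - of_real pi * C"
    proof -
      have "S \<noteq> 0" using s0 by (simp add: S_def)
      then have "of_real pi * (D * S) = (of_real pi / S * D) * S\<^sup>2" by (simp add: power2_eq_square)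
      also have "\<dots> = of_real pi * (- of_real pi * C)"
        unfolding \<open>of_real pi / S * D = _\<close> using \<open>S \<noteq> 0\<close> by simp
      finally show ?thesis by (subst (asm) mult_cancel_left) auto
    qed
    then show ?thesis
      using s0 unfolding cot_def S_def[symmetric] C_def[symmetric] D_def[symmetric] by (simp add: divide_simps)
  qed
  have "(\<lambda>m. (of_real (ln (real m)) - (\<Sum>n<m. inverse (z + of_nat n))) - (of_real (ln (real m)) - (\<Sum>n<m. inverse (1 - z + of_nat n))))
          \<longlonglongrightarrow> Digamma z - Digamma (1 - z)"
    using nz[of 0] nz(2)[of 1] by (intro tendsto_diff Digamma_LIMSEQ) auto
  then have lim: "(\<lambda>m. (\<Sum>n<m. inverse (1 - z + of_nat n)) - (\<Sum>n<m. inverse (z + of_nat n))) \<longlonglongrightarrow> - of_real pi * cot (of_real pi * z)"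
    unfolding dg by simp
  \<comment> \<open>Each summand splits into two simple fractions. The second one has its index
    shifted by one against the Digamma sum, which accounts for \<open>1 / z\<close> and the end
    term.\<close>
  have eq: "(\<Sum>n<m. 2 * z / ((of_nat (Suc n))\<^sup>2 - z\<^sup>2)) =
      ((\<Sum>n<m. inverse (1 - z + of_nat n)) - (\<Sum>n<m. inverse (z + of_nat n))) + 1 / z - inverse (z + of_nat m)" for m
  proof (induction m)
    case 0
    then show ?case by (simp add: divide_inverse)
  next
    case (Suc m)
    have fac: "(of_nat (Suc m))\<^sup>2 - z\<^sup>2 = (of_nat (Suc m) - z) * (z + of_nat (Suc m))"
      by (simp add: power2_eq_square algebra_simps)
    have "2 * z / ((of_nat (Suc m))\<^sup>2 - z\<^sup>2) = inverse (of_nat (Suc m) - z) - inverse (z + of_nat (Suc m))"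
      unfolding fac using nz[of "Suc m"] by (simp add: field_simps del: of_nat_Suc)
    also have "of_nat (Suc m) - z = 1 - z + of_nat m" by simp
    finally have "2 * z / ((of_nat (Suc m))\<^sup>2 - z\<^sup>2) = inverse (1 - z + of_nat m) - inverse (z + of_nat (Suc m))" .
    then show ?case unfolding sum.lessThan_Suc Suc.IH by (simp only:) (simp only: algebra_simps)
  qed
  have "filterlim (\<lambda>m. z + of_nat m) at_infinity sequentially"
    by (rule tendsto_add_filterlim_at_infinity[OF tendsto_const tendsto_of_nat])
  then have "(\<lambda>m. inverse (z + of_nat m)) \<longlonglongrightarrow> 0"
    by (rule filterlim_compose[OF tendsto_inverse_0])
  then have "(\<lambda>m. (((\<Sum>n<m. inverse (1 - z + of_nat n)) - (\<Sum>n<m. inverse (z + of_nat n))) + 1 / z) - inverse (z + of_nat m)) \<longlonglongrightarrow> (- of_real pi * cot (of_real pi * z) + 1 / z) - 0"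
    by (intro tendsto_diff tendsto_add lim tendsto_const)
  then show ?thesis unfolding sums_def eq by (simp add: algebra_simps)
qed

text \<open>The cotangent expansion at the imaginary point \<open>\<i> * t / (2 * pi)\<close>. There
  \<open>pi * cot\<close> becomes \<open>- \<i> * pi\<close> times the hyperbolic cotangent of
  \<open>t / 2\<close>, which is \<open>(E + 1) / (E - 1)\<close>.\<close>

lemma bose_partial_fractions:
  fixes t :: real
  assumes t: "t > 0"
  shows "(\<lambda>k. 2 * t / (t\<^sup>2 + (2 * pi * real (Suc k))\<^sup>2)) sums (1 / (exp t - 1) - 1 / t + 1 / 2)"
proof -
  define y where "y = t / (2 * pi)"
  define z where "z = \<i> * complex_of_real y"
  have y: "y > 0" using t by (simp add: y_def)
  have ty: "t = 2 * pi * y" by (simp add: y_def)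
  have zI: "z \<notin> \<int>" using y by (auto simp: z_def complex_is_Int_iff)
  define E where "E = exp t"
  have E: "E > 1" using t by (simp add: E_def)
  have "exp (pi * y) * exp (pi * y) = E" by (simp add: E_def ty flip: exp_add)
  then have E2: "exp (- (pi * y)) = exp (pi * y) / E" using E by (simp add: exp_minus field_simps)
  have iz: "\<i> * (of_real pi * z) = of_real (- (pi * y))" by (simp add: z_def complex_eq_iff)
  have c: "cos (of_real pi * z) = of_real (exp (pi * y) * (1 + 1 / E) / 2)"
    unfolding cos_exp_eq iz mult_minus_left iz exp_of_real E2 of_real_minus[symmetric] by (simp add: algebra_simps)
  have s: "sin (of_real pi * z) = \<i> * of_real (exp (pi * y) * (1 - 1 / E) / 2)"
    unfolding sin_exp_eq iz mult_minus_left iz exp_of_real E2 of_real_minus[symmetric] using E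
    by (simp add: field_simps)
  have cot: "cot (of_real pi * z) = - \<i> * of_real ((E + 1) / (E - 1))"
    unfolding cot_def c s using E by (simp add: field_simps)
  \<comment> \<open>All terms are purely imaginary, so the imaginary parts carry the whole identity;
    afterwards only the scaling by \<open>1 / (2 * pi)\<close> remains.\<close>
  have "(\<lambda>n. Im (2 * z / ((of_nat (Suc n))\<^sup>2 - z\<^sup>2))) sums Im (1 / z - of_real pi * cot (of_real pi * z))"
    by (rule sums_Im[OF cot_partial_fractions[OF zI]])
  moreover have "Im (2 * z / ((of_nat (Suc n))\<^sup>2 - z\<^sup>2)) = 2 * y / ((real (Suc n))\<^sup>2 + y\<^sup>2)" for n
  proof -
    have "2 * z / ((of_nat (Suc n))\<^sup>2 - z\<^sup>2) = \<i> * of_real (2 * y / ((real (Suc n))\<^sup>2 + y\<^sup>2))"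
      by (simp add: z_def power_mult_distrib)
    then show ?thesis by (simp only:) simp
  qed
  moreover have "Im (1 / z - of_real pi * cot (of_real pi * z)) = pi * ((E + 1) / (E - 1)) - 1 / y"
    unfolding cot using y by (simp add: z_def Im_divide power2_eq_square)
  ultimately have "(\<lambda>n. 2 * y / ((real (Suc n))\<^sup>2 + y\<^sup>2)) sums (pi * ((E + 1) / (E - 1)) - 1 / y)" by simp
  then have "(\<lambda>n. 1 / (2 * pi) * (2 * y / ((real (Suc n))\<^sup>2 + y\<^sup>2))) sums (1 / (2 * pi) * (pi * ((E + 1) / (E - 1)) - 1 / y))"
    by (rule sums_mult)
  also have "(\<lambda>n. 1 / (2 * pi) * (2 * y / ((real (Suc n))\<^sup>2 + y\<^sup>2))) = (\<lambda>n. 2 * t / (t\<^sup>2 + (2 * pi * real (Suc n))\<^sup>2))"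
  proof
    fix n
    define u where "u = real (Suc n)"
    have "t\<^sup>2 + (2 * pi * u)\<^sup>2 = (2 * pi)\<^sup>2 * (u\<^sup>2 + y\<^sup>2)"
      unfolding ty power_mult_distrib by (simp add: distrib_left mult_ac)
    moreover have "2 * t = (2 * pi)\<^sup>2 * (1 / (2 * pi) * (2 * y))" by (simp add: ty power2_eq_square)
    ultimately have "2 * t / (t\<^sup>2 + (2 * pi * u)\<^sup>2) = ((2 * pi)\<^sup>2 * (1 / (2 * pi) * (2 * y))) / ((2 * pi)\<^sup>2 * (u\<^sup>2 + y\<^sup>2))"
      by (simp only:)
    also have "\<dots> = 1 / (2 * pi) * (2 * y) / (u\<^sup>2 + y\<^sup>2)"
      by (rule mult_divide_mult_cancel_left) simp
    finally show "1 / (2 * pi) * (2 * y / ((real (Suc n))\<^sup>2 + y\<^sup>2)) = 2 * t / (t\<^sup>2 + (2 * pi * real (Suc n))\<^sup>2)"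
      unfolding u_def by simp
  qed
  also have "1 / (2 * pi) * (pi * ((E + 1) / (E - 1)) - 1 / y) = 1 / (E - 1) - 1 / t + 1 / 2"
  proof -
    have "(E + 1) / (E - 1) = 1 + 2 / (E - 1)" using E by (simp add: field_simps)
    moreover have "1 / (2 * pi) * (1 / y) = 1 / t" by (simp add: ty)
    ultimately show ?thesis by (simp add: right_diff_distrib distrib_left)
  qed
  finally show ?thesis by (simp add: E_def)
qed

section \<open>Power and exponential integrals of the trapezoidal kernel over unit intervals\<close>

definition zeta_real_term :: "real \<Rightarrow> nat \<Rightarrow> real" where
  "zeta_real_term s n = integral {real n..real n + 1} (\<lambda>x. (x - real n) * (real n + 1 - x) / 2 * x powr (- s - 2))"

text \<open>On the interval at 0 the integrand equals
  \<open>(x powr (- s - 1) - x powr (- s)) / 2\<close>, whose singularity is integrable because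
  \<open>s < 0\<close>. The value is the one that absorbs the summand \<open>(s - 1) / 2 + 1\<close>
  of \<open>zeta_num\<close>.\<close>

lemma zeta_real_term_0:
  assumes "-1 < s" "s < 0"
  shows "((\<lambda>x. (x - real 0) * (real 0 + 1 - x) / 2 * x powr (- s - 2)) has_integral 1 / (2 * s * (s - 1))) {real 0..real 0 + 1}"
proof -
  have "((\<lambda>x. 1 / 2 * (x powr (- s - 1) - x powr (- s))) has_integral
      1 / 2 * (1 powr (- s - 1 + 1) / (- s - 1 + 1) - 1 powr (- s + 1) / (- s + 1))) {0..1}"
    using assms by (intro has_integral_mult_right has_integral_diff has_integral_powr_from_0) auto
  also have "1 / 2 * (1 powr (- s - 1 + 1) / (- s - 1 + 1) - 1 powr (- s + 1) / (- s + 1)) = 1 / (2 * s * (s - 1))"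
    using assms by (simp add: divide_simps)
  finally have "((\<lambda>x. 1 / 2 * (x powr (- s - 1) - x powr (- s))) has_integral 1 / (2 * s * (s - 1))) {0..1}" .
  moreover have "1 / 2 * (x powr (- s - 1) - x powr (- s)) = (x - real 0) * (real 0 + 1 - x) / 2 * x powr (- s - 2)"
    if "x \<in> {0..1}" for x
  \<comment> \<open>At \<open>x = 0\<close> both sides are 0, since \<open>0 powr y\<close> is 0 for
    every exponent.\<close>
  proof (cases "x = 0")
    case False
    have "x powr (1 + (- s - 2)) = x powr 1 * x powr (- s - 2)" "x powr (2 + (- s - 2)) = x powr 2 * x powr (- s - 2)"
      by (rule powr_add)+
    moreover have "1 + (- s - 2) = - s - 1" "2 + (- s - 2) = - s" by simp_all
    moreover have "x powr 1 = x" "x powr 2 = x * x" using that by (simp_all add: power2_eq_square)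
    ultimately have "x powr (- s - 1) = x * x powr (- s - 2)" "x powr (- s) = x * x * x powr (- s - 2)"
      by (simp_all only:)
    then show ?thesis by (simp only: of_nat_0) (simp add: algebra_simps diff_divide_distrib)
  qed simp
  ultimately have "((\<lambda>x. (x - real 0) * (real 0 + 1 - x) / 2 * x powr (- s - 2)) has_integral 1 / (2 * s * (s - 1))) {0..1}"
    by (rule has_integral_eq[rotated])
  then show ?thesis by simp
qed

lemma zeta_real_term_has_integral:
  assumes "-1 < s" "s < 0"
  shows "((\<lambda>x. (x - real n) * (real n + 1 - x) / 2 * x powr (- s - 2)) has_integral zeta_real_term s n) {real n..real n + 1}"
proof -
  have "(\<lambda>x. (x - real n) * (real n + 1 - x) / 2 * x powr (- s - 2)) integrable_on {real n..real n + 1}"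
  proof (cases "n = 0")
    case True
    show ?thesis unfolding True by (rule has_integral_integrable[OF zeta_real_term_0[OF assms]])
  next
    case False
    then show ?thesis by (intro integrable_continuous_interval continuous_intros) auto
  qed
  then show ?thesis unfolding zeta_real_term_def by (rule integrable_integral)
qed

lemma zeta_real_term_nonneg:
  assumes "-1 < s" "s < 0"
  shows "zeta_real_term s n \<ge> 0"
  by (rule has_integral_nonneg[OF zeta_real_term_has_integral[OF assms]]) auto

lemma zeta_term_of_real:
  assumes "-1 < s" "s < 0"
  shows "zeta_term (Suc n) (of_real s) = of_real ((s - 1) * s * (s + 1) * zeta_real_term s (Suc n))"
proof -
  let ?I = "{real (Suc n)..real (Suc n) + 1}"
  let ?q = "\<lambda>x. (x - real (Suc n)) * (real (Suc n) + 1 - x) / 2"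
  have "((\<lambda>x. of_real ((s - 1) * s * (s + 1) * (?q x * x powr (- s - 2))) :: complex) has_integral
      of_real ((s - 1) * s * (s + 1) * zeta_real_term s (Suc n))) ?I"
    by (intro has_integral_of_real has_integral_mult_right zeta_real_term_has_integral assms)
  moreover have "of_real ((s - 1) * s * (s + 1) * (?q x * x powr (- s - 2))) =
     ?q x *\<^sub>R ((of_real s - 1) * of_real s * (of_real s + 1) * complex_of_real x powr (- of_real s - 2))" if "x \<in> ?I" for x
  proof -
    have "x \<ge> 0" using that by auto
    then have "complex_of_real x powr (- of_real s - 2) = of_real (x powr (- s - 2))"
      using powr_of_real[of x "- s - 2"] by simp
    then show ?thesis by (simp add: scaleR_conv_of_real mult_ac)
  qed
  ultimately have "((\<lambda>x. ?q x *\<^sub>R ((of_real s - 1) * of_real s * (of_real s + 1) * of_real x powr (- of_real s - 2))) has_integral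
      complex_of_real ((s - 1) * s * (s + 1) * zeta_real_term s (Suc n))) ?I"
    by (rule has_integral_eq[rotated])
  moreover have "((\<lambda>x. ?q x *\<^sub>R ((of_real s - 1) * of_real s * (of_real s + 1) * of_real x powr (- of_real s - 2))) has_integral
      zeta_term (Suc n) (of_real s)) ?I"
    by (rule zeta_term_has_integral) simp
  ultimately show ?thesis by (rule has_integral_unique[symmetric])
qed

text \<open>The trapezoidal rule for \<open>exp (- x * t)\<close>, whose second derivative is
  \<open>t\<^sup>2\<close> times itself; hence the final division by
  \<open>t\<^sup>2\<close>.\<close>

lemma exp_kernel_has_integral:
  fixes t :: real
  assumes t: "t > 0"
  shows "((\<lambda>x. (x - real n) * (real n + 1 - x) / 2 * exp (- x * t)) has_integral
           exp (- t) ^ n * ((1 + exp (- t)) / 2 - (1 - exp (- t)) / t) / t\<^sup>2) {real n..real n + 1}"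
proof -
  have e: "exp (- (real n * t)) = exp (- t) ^ n" "exp (- ((real n + 1) * t)) = exp (- t) ^ n * exp (- t)"
    by (simp_all add: exp_of_nat_mult[symmetric] exp_add[symmetric] algebra_simps)
  have "((\<lambda>x. ((x - real n) * (real n + 1 - x) / 2) *\<^sub>R (t\<^sup>2 * exp (- (x * t)))) has_integral
      ((1/2) *\<^sub>R (exp (- (real n * t)) + exp (- ((real n + 1) * t))) - ((- exp (- ((real n + 1) * t)) / t) - (- exp (- (real n * t)) / t)))) {real n..real n + 1}"
    by (rule trapezoid_error_has_integral[where \<phi>' = "\<lambda>x. - t * exp (- (x * t))"])
       (use t in \<open>auto intro!: derivative_eq_intros simp flip: has_real_derivative_iff_has_vector_derivative simp: power2_eq_square\<close>)
  from has_integral_divide[OF this, of "t\<^sup>2"] show ?thesis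
    unfolding e by (rule has_integral_eq_rhs[OF has_integral_eq, rotated 1])
      (use t in \<open>auto simp: field_simps\<close>)
qed

text \<open>A geometric series with ratio \<open>exp (- t)\<close>; its sum turns the integrals over
  the unit intervals into the kernel expanded in \<open>bose_partial_fractions\<close>.\<close>

lemma sums_exp_kernel:
  fixes t :: real
  assumes t: "t > 0"
  shows "(\<lambda>n. exp (- t) ^ n * ((1 + exp (- t)) / 2 - (1 - exp (- t)) / t) / t\<^sup>2) sums
           ((1 / (exp t - 1) - 1 / t + 1 / 2) / t\<^sup>2)"
proof -
  define E where "E = exp (- t)"
  have E: "0 < E" "E < 1" using t by (auto simp: E_def)
  have et: "exp t = 1 / E" by (simp add: E_def exp_minus inverse_eq_divide)
  have "(\<lambda>n. E ^ n * (((1 + E) / 2 - (1 - E) / t) / t\<^sup>2)) sums (1 / (1 - E) * (((1 + E) / 2 - (1 - E) / t) / t\<^sup>2))"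
    by (intro sums_mult2 geometric_sums) (use E in auto)
  also have "1 / (1 - E) * (((1 + E) / 2 - (1 - E) / t) / t\<^sup>2) = (1 / (exp t - 1) - 1 / t + 1 / 2) / t\<^sup>2"
  proof -
    have "1 / (exp t - 1) = E / (1 - E)" unfolding et using E by (simp add: field_simps)
    moreover have "1 / (1 - E) * ((1 + E) / 2 - (1 - E) / t) = E / (1 - E) + 1 / 2 - 1 / t"
      using E t by (simp add: field_simps)
    ultimately show ?thesis by (simp add: algebra_simps)
  qed
  finally show ?thesis unfolding E_def by simp
qed

lemma zeta_functional_real:
  fixes s :: real
  assumes s: "-1 < s" "s < 0"
  shows "complex_of_real (Gamma s) * (zeta_num (of_real s) / (of_real s - 1)) =
     of_real (Gamma ((1 + s) / 2) * Gamma ((1 - s) / 2) * (2 * pi) powr (s - 1)) * (zeta_num (1 - of_real s) / (- of_real s))"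
proof -
  define G where "G = Gamma (s + 2)"
  have G: "G > 0" using s by (auto simp: G_def intro!: Gamma_real_pos)
  define C where "C = Gamma ((1 + s) / 2) * Gamma ((1 - s) / 2) * (2 * pi) powr (s - 1)"
  have C: "C > 0" using s by (auto simp: C_def intro!: Gamma_real_pos mult_pos_pos)
  define q where "q n x = (x - real n) * (real n + 1 - x) / 2" for n x
  define I where "I n = {real n..real n + 1}" for n
  define b where "b n t = exp (- t) ^ n * ((1 + exp (- t)) / 2 - (1 - exp (- t)) / t) / t\<^sup>2" for n and t :: real
  have q: "q n x \<ge> 0" if "x \<in> I n" for n x using that by (auto simp: q_def I_def)
  \<comment> \<open>The integrand behind the Laplace integral for
    \<open>Gamma (s + 2) * x powr (- s - 2)\<close>. Integrating over \<open>t\<close> first (fact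
    1) leads to \<open>zeta_real_term\<close>, over \<open>x\<close> first (fact 2) to the
    exponential kernel \<open>b\<close>.\<close>
  define F where "F n x t = ennreal (q n x * (t powr (s + 1) * exp (- x * t))) * indicator (I n) x * indicator {0<..} t" for n x t
  have 1: "(\<integral>\<^sup>+t. F n x t \<partial>lborel) = ennreal (G * (q n x * x powr (- s - 2))) * indicator (I n) x" for n x
  proof (cases "x \<in> I n \<and> x \<noteq> 0")
    case True
    then have x: "x > 0" by (auto simp: I_def)
    have "(\<integral>\<^sup>+t. F n x t \<partial>lborel) = (\<integral>\<^sup>+t. ennreal (q n x) * (ennreal (t powr (1 * (s + 2) - 1) * exp (- x * t powr 1)) * indicator {0<..} t) \<partial>lborel)"
      by (intro nn_integral_cong) (use True q[of x n] in \<open>auto simp: F_def ennreal_mult' add.commute[of 1 s] split: split_indicator\<close>)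
    also have "\<dots> = ennreal (q n x) * ennreal (Gamma (s + 2) * x powr (- (s + 2)) / 1)"
      using x s by (intro nn_integral_cmult_Gamma_powr) auto
    also have "\<dots> = ennreal (q n x * (Gamma (s + 2) * x powr (- (s + 2)) / 1))"
      using q True by (intro ennreal_mult'[symmetric]) auto
    finally show ?thesis using True by (simp add: G_def mult_ac)
  next
    case False
    \<comment> \<open>The point 0 lies only in the first interval, and there \<open>q\<close>
      vanishes, so the divergent Laplace integral at \<open>x = 0\<close> is multiplied by
      0.\<close>
    then consider "x \<notin> I n" | "x = 0" "n = 0" by (cases "n = 0") (auto simp: I_def)
    then show ?thesis by cases (auto simp: F_def q_def)
  qed
  have 2: "(\<integral>\<^sup>+x. F n x t \<partial>lborel) = ennreal (t powr (s + 1) * b n t) * indicator {0<..} t" for n t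
  proof (cases "t > 0")
    case True
    have "((\<lambda>x. t powr (s + 1) * (q n x * exp (- x * t))) has_integral t powr (s + 1) * b n t) (I n)"
      unfolding q_def b_def I_def by (rule has_integral_mult_right[OF exp_kernel_has_integral[OF True]])
    then have "(\<integral>\<^sup>+x. ennreal (t powr (s + 1) * (q n x * exp (- x * t))) * indicator (I n) x \<partial>lborel) = ennreal (t powr (s + 1) * b n t)"
      by (rule nn_integral_has_integral_lebesgue'[rotated]) (use q in auto)
    then show ?thesis using True by (simp add: F_def mult_ac)
  qed (simp add: F_def)
  have b: "b n t \<ge> 0" if "t > 0" for n t
    using exp_kernel_has_integral[OF that] unfolding b_def
    by (rule has_integral_nonneg) auto
  have 3: "ennreal (G * zeta_real_term s n) = (\<integral>\<^sup>+t. ennreal (t powr (s + 1) * b n t) * indicator {0<..} t \<partial>lborel)" for n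
  proof -
    have "((\<lambda>x. G * (q n x * x powr (- s - 2))) has_integral G * zeta_real_term s n) (I n)"
      unfolding q_def I_def by (rule has_integral_mult_right[OF zeta_real_term_has_integral[OF s]])
    then have "ennreal (G * zeta_real_term s n) = (\<integral>\<^sup>+x. ennreal (G * (q n x * x powr (- s - 2))) * indicator (I n) x \<partial>lborel)"
      by (intro nn_integral_has_integral_lebesgue'[symmetric]) (use G q in auto)
    also have "\<dots> = (\<integral>\<^sup>+x. \<integral>\<^sup>+t. F n x t \<partial>lborel \<partial>lborel)" by (simp add: 1)
    also have "\<dots> = (\<integral>\<^sup>+t. \<integral>\<^sup>+x. F n x t \<partial>lborel \<partial>lborel)"
      by (rule lborel_pair.Fubini'[symmetric]) (simp add: F_def q_def I_def)
    finally show ?thesis by (simp add: 2)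
  qed
  define c where "c k = 2 * pi * real (Suc k)" for k
  have c: "c k > 0" for k by (simp add: c_def)
  \<comment> \<open>Both series represent the same function of \<open>t\<close>: the geometric one
    from the unit intervals, and the partial fractions, which can again be integrated term by
    term.\<close>
  have 4: "(\<Sum>n. ennreal (t powr (s + 1) * b n t) * indicator {0<..} t) = (\<Sum>k. ennreal 2 * (ennreal (t powr s / (t\<^sup>2 + (c k)\<^sup>2)) * indicator {0<..} t))" for t
  proof (cases "t > 0")
    case True
    let ?S = "t powr (s + 1) * ((1 / (exp t - 1) - 1 / t + 1 / 2) / t\<^sup>2)"
    have S1: "(\<lambda>n. t powr (s + 1) * b n t) sums ?S"
      unfolding b_def by (intro sums_mult sums_exp_kernel True)
    have "(\<lambda>k. t powr (s + 1) * ((2 * t / (t\<^sup>2 + (c k)\<^sup>2)) / t\<^sup>2)) sums ?S"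
      unfolding c_def by (intro sums_mult sums_divide bose_partial_fractions True)
    also have "(\<lambda>k. t powr (s + 1) * ((2 * t / (t\<^sup>2 + (c k)\<^sup>2)) / t\<^sup>2)) = (\<lambda>k. 2 * (t powr s / (t\<^sup>2 + (c k)\<^sup>2)))"
    proof
      fix k
      have "t powr (s + 1) = t * t powr s" using True by (simp add: powr_add)
      then show "t powr (s + 1) * ((2 * t / (t\<^sup>2 + (c k)\<^sup>2)) / t\<^sup>2) = 2 * (t powr s / (t\<^sup>2 + (c k)\<^sup>2))"
        using True by (simp add: power2_eq_square)
    qed
    finally have S2: "(\<lambda>k. 2 * (t powr s / (t\<^sup>2 + (c k)\<^sup>2))) sums ?S" .
    have "(\<Sum>n. ennreal (t powr (s + 1) * b n t)) = ennreal ?S"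
      by (rule suminf_ennreal_eq[OF _ S1]) (use b True in auto)
    also have "\<dots> = (\<Sum>k. ennreal (2 * (t powr s / (t\<^sup>2 + (c k)\<^sup>2))))"
      by (rule suminf_ennreal_eq[OF _ S2, symmetric]) auto
    also have "\<dots> = (\<Sum>k. ennreal 2 * ennreal (t powr s / (t\<^sup>2 + (c k)\<^sup>2)))"
      by (rule suminf_cong, rule ennreal_mult') auto
    finally show ?thesis using True by simp
  qed simp
  have "(\<Sum>n. ennreal (G * zeta_real_term s n)) = (\<integral>\<^sup>+t. (\<Sum>n. ennreal (t powr (s + 1) * b n t) * indicator {0<..} t) \<partial>lborel)"
    unfolding 3 by (rule nn_integral_suminf[symmetric]) (simp add: b_def)
  also have "\<dots> = (\<Sum>k. \<integral>\<^sup>+t. ennreal 2 * (ennreal (t powr s / (t\<^sup>2 + (c k)\<^sup>2)) * indicator {0<..} t) \<partial>lborel)"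
    unfolding 4 by (rule nn_integral_suminf) simp
  also have "\<dots> = (\<Sum>k. ennreal (C * real (Suc k) powr (s - 1)))"
  proof (rule suminf_cong)
    fix k
    have "(\<integral>\<^sup>+t. ennreal 2 * (ennreal (t powr s / (t\<^sup>2 + (c k)\<^sup>2)) * indicator {0<..} t) \<partial>lborel)
       = ennreal 2 * ennreal (Gamma ((1 + s) / 2) * Gamma ((1 - s) / 2) / 2 * c k powr (s - 1))"
      using s c by (subst nn_integral_cmult, simp) (subst nn_integral_powr_over_quadratic, auto)
    also have "\<dots> = ennreal (2 * (Gamma ((1 + s) / 2) * Gamma ((1 - s) / 2) / 2 * c k powr (s - 1)))"
      by (rule ennreal_mult'[symmetric]) simp
    also have "2 * (Gamma ((1 + s) / 2) * Gamma ((1 - s) / 2) / 2 * c k powr (s - 1)) = C * real (Suc k) powr (s - 1)"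
      by (simp add: C_def c_def powr_mult)
    finally show "(\<integral>\<^sup>+t. ennreal 2 * (ennreal (t powr s / (t\<^sup>2 + (c k)\<^sup>2)) * indicator {0<..} t) \<partial>lborel) = ennreal (C * real (Suc k) powr (s - 1))" .
  qed
  also have "\<dots> = ennreal (\<Sum>k. C * real (Suc k) powr (s - 1))"
    using C s by (intro suminf_ennreal2 summable_mult summable_Suc_powr) auto
  finally have tot: "(\<Sum>n. ennreal (G * zeta_real_term s n)) = ennreal (\<Sum>k. C * real (Suc k) powr (s - 1))" .
  define Z where "Z = (\<Sum>k. real (Suc k) powr (s - 1))"
  have sZ: "(\<lambda>k. real (Suc k) powr (s - 1)) sums Z"
    unfolding Z_def using s by (intro summable_sums summable_Suc_powr) auto
  \<comment> \<open>The total is finite, so the series of the non-negative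
    \<open>zeta_real_term\<close> values converges as a real series.\<close>
  have "(\<lambda>n. ennreal (G * zeta_real_term s n)) sums ennreal (C * Z)"
    using tot sums_unique[OF sums_mult[OF sZ, of C]] summable_sums[OF summableI, of "\<lambda>n. ennreal (G * zeta_real_term s n)"] by simp
  then have "(\<lambda>n. G * zeta_real_term s n) sums (C * Z)"
    using G C zeta_real_term_nonneg[OF s] sums_le[OF _ sums_zero sZ] by (subst (asm) sums_ennreal) auto
  from sums_mult[OF this, of "1 / G"] have sA: "zeta_real_term s sums (C * Z / G)" using G by simp
  have A0: "zeta_real_term s 0 = 1 / (2 * s * (s - 1))"
    by (rule has_integral_unique[OF zeta_real_term_has_integral[OF s, of 0] zeta_real_term_0[OF s]])
  have "(\<lambda>n. zeta_real_term s (Suc n)) sums (C * Z / G - zeta_real_term s 0)"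
    using sA by (subst sums_Suc_iff) simp
  then have "(\<lambda>n. complex_of_real ((s - 1) * s * (s + 1) * zeta_real_term s (Suc n))) sums of_real ((s - 1) * s * (s + 1) * (C * Z / G - zeta_real_term s 0))"
    by (intro sums_of_real sums_mult)
  then have "(\<Sum>n. zeta_term (Suc n) (of_real s)) = of_real ((s - 1) * s * (s + 1) * (C * Z / G - zeta_real_term s 0))"
    unfolding zeta_term_of_real[OF s] by (rule sums_unique[symmetric])
  then have "zeta_num (of_real s) = of_real ((s - 1) / 2 + 1 + (s - 1) * s * (s + 1) * (C * Z / G - zeta_real_term s 0))"
    by (simp add: zeta_num_def)
  \<comment> \<open>The term with index 0 contributes \<open>(s + 1) / 2\<close>, which equals
    \<open>(s - 1) / 2 + 1\<close>; the two cancel and only the full sum over all intervals is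
    left.\<close>
  also have "(s - 1) / 2 + 1 + (s - 1) * s * (s + 1) * (C * Z / G - zeta_real_term s 0) = (s - 1) * (s * (s + 1)) * (C * Z / G)"
  proof -
    define X where "X = C * Z / G"
    have "(s - 1) * s * (s + 1) * (1 / (2 * s * (s - 1))) = (s + 1) / 2"
      using s by (simp add: divide_simps)
    moreover have "(s - 1) / 2 + 1 = (s + 1) / 2" by (simp add: field_simps)
    ultimately show ?thesis unfolding A0 X_def[symmetric] right_diff_distrib[of _ X] by (simp only: mult.assoc)
  qed
  finally have zn: "zeta_num (of_real s) = of_real ((s - 1) * (s * (s + 1)) * (C * Z / G))" .
  have zs: "zeta_num (of_real s) / (of_real s - 1) = of_real (s * (s + 1) * (C * Z / G))"
  proof -
    have "of_real (s * (s + 1) * (C * Z / G)) = (complex_of_real ((s - 1) * (s * (s + 1)) * (C * Z / G)) / of_real (s - 1))"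
      unfolding of_real_divide[symmetric] using s by (simp only: mult.assoc) simp
    then show ?thesis unfolding zn by simp
  qed
  have "(\<lambda>n. of_nat (Suc n) powr (- (1 - of_real s))) sums (zeta_num (1 - of_real s) / (1 - of_real s - 1))"
    by (rule zeta_series_sums) (use s in simp)
  also have "(\<lambda>n. of_nat (Suc n) powr (- (1 - of_real s))) = (\<lambda>n. complex_of_real (real (Suc n) powr (s - 1)))"
  proof
    fix n
    show "of_nat (Suc n) powr (- (1 - of_real s)) = complex_of_real (real (Suc n) powr (s - 1))"
      using powr_of_real[of "real (Suc n)" "s - 1"] by (simp del: of_nat_Suc)
  qed
  finally have "zeta_num (1 - of_real s) / (1 - of_real s - 1) = complex_of_real Z"
    by (rule sums_unique2) (rule sums_of_real[OF sZ])
  then have z1: "zeta_num (1 - of_real s) / (- of_real s) = complex_of_real Z" by simp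
  have "G = (s + 1) * (s * Gamma s)"
  proof -
    have "s \<notin> \<int>\<^sub>\<le>\<^sub>0" "s + 1 \<notin> \<int>\<^sub>\<le>\<^sub>0"
      using s by (auto elim!: nonpos_Ints_cases)
    note this[THEN Gamma_plus1]
    then have "Gamma (s + 1 + 1) = (s + 1) * (s * Gamma s)" by (simp only:)
    moreover have "s + 1 + 1 = s + 2" by simp
    ultimately show ?thesis by (simp only: G_def)
  qed
  then have "Gamma s * (s * (s + 1) * (C * Z / G)) = G * (C * Z / G)" by (simp only: mult_ac)
  also have "\<dots> = C * Z" using G by simp
  finally have "Gamma s * (s * (s + 1) * (C * Z / G)) = C * Z" .
  then have "complex_of_real (Gamma s * (s * (s + 1) * (C * Z / G))) = of_real (C * Z)" by (rule arg_cong)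
  then show ?thesis unfolding zs z1 C_def[symmetric] by (simp only: of_real_mult)
qed

section \<open>The zeta function and the symmetry of its zeros\<close>

text \<open>Legendre duplication splits \<open>Gamma s\<close>, after which the factor
  \<open>Gamma ((1 + s) / 2)\<close> cancels. Reciprocal Gamma functions make the remaining factors
  entire, and \<open>s / 2 + 1\<close> in place of \<open>s / 2\<close> absorbs the denominator
  \<open>s\<close>, so the identity can be continued without exceptional points.\<close>

lemma zeta_num_functional_real:
  fixes s :: real
  assumes s: "-1 < s" "s < 0"
  shows "2 * rGamma ((1 - of_real s) / 2) * zeta_num (of_real s) =
     of_real pi powr (of_real s - 1 / 2) * rGamma (of_real s / 2 + 1) * zeta_num (1 - of_real s) * (1 - of_real s)"
proof -
  define z where "z = complex_of_real s"
  have z: "z \<noteq> 0" "z - 1 \<noteq> 0" using s by (auto simp: z_def complex_eq_iff)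
  have nI: "z / 2 \<notin> \<int>\<^sub>\<le>\<^sub>0" "(1 + z) / 2 \<notin> \<int>\<^sub>\<le>\<^sub>0" "(1 - z) / 2 \<notin> \<int>\<^sub>\<le>\<^sub>0" "z \<notin> \<int>\<^sub>\<le>\<^sub>0" "z / 2 + 1 \<notin> \<int>\<^sub>\<le>\<^sub>0"
    using s by (auto simp: z_def complex_eq_iff elim!: nonpos_Ints_cases)
  define a b c where "a = Gamma (z / 2)" and "b = Gamma ((1 + z) / 2)" and "c = Gamma ((1 - z) / 2)"
  have abc: "a \<noteq> 0" "b \<noteq> 0" "c \<noteq> 0" using nI by (auto simp: a_def b_def c_def Gamma_eq_zero_iff)
  define P where "P = complex_of_real ((2 * pi) powr (s - 1))"
  \<comment> \<open>The elementary factor of the duplication formula at \<open>z / 2\<close>. Its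
    power of 2 cancels against the one in \<open>P\<close>, leaving a pure power of
    \<open>pi\<close>.\<close>
  define Q where "Q = exp ((1 - z) * of_real (ln 2)) * complex_of_real (sqrt pi)"
  have PQ: "P * Q = of_real pi powr (z - 1 / 2)"
  proof -
    have "Q = of_real (exp ((1 - s) * ln 2) * sqrt pi)" by (simp add: Q_def z_def flip: exp_of_real)
    also have "exp ((1 - s) * ln 2) * sqrt pi = 2 powr (1 - s) * pi powr (1 / 2)"
      unfolding powr_half_sqrt[OF pi_ge_zero] by (simp add: powr_def)
    finally have "P * Q = of_real ((2 powr (s - 1) * 2 powr (1 - s)) * (pi powr (s - 1) * pi powr (1/2)))"
      by (simp add: P_def powr_mult mult_ac)
    also have "(2 powr (s - 1) * 2 powr (1 - s)) * (pi powr (s - 1) * pi powr (1/2)) = pi powr (s - 1 / 2)"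
      by (simp flip: powr_add add: algebra_simps)
    also have "complex_of_real \<dots> = of_real pi powr (z - 1 / 2)"
      using powr_of_real[of pi "s - 1/2"] by (simp add: z_def)
    finally show ?thesis .
  qed
  have Q0: "Q \<noteq> 0" by (simp add: Q_def)
  have "Gamma (z / 2) * Gamma (z / 2 + 1 / 2) = exp ((1 - 2 * (z / 2)) * of_real (ln 2)) * of_real (sqrt pi) * Gamma (2 * (z / 2))"
    by (rule Gamma_legendre_duplication) (use nI in \<open>simp_all add: add_divide_distrib add.commute\<close>)
  then have dup: "a * b = Q * Gamma z"
    by (simp add: a_def b_def Q_def add_divide_distrib add.commute)
  have "complex_of_real (Gamma s) = Gamma z" "complex_of_real (Gamma ((1 + s) / 2)) = b" "complex_of_real (Gamma ((1 - s) / 2)) = c"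
    unfolding Gamma_complex_of_real[symmetric] by (simp_all add: z_def b_def c_def)
  with zeta_functional_real[OF s] have "Gamma z * (zeta_num z / (z - 1)) = b * c * P * (zeta_num (1 - z) / (- z))"
    by (simp only: of_real_mult P_def z_def[symmetric])
  then have "Q * Gamma z * (zeta_num z / (z - 1)) = b * (c * (P * Q)) * (zeta_num (1 - z) / (- z))"
    by (simp only: mult_ac)
  then have "b * (a * (zeta_num z / (z - 1))) = b * (c * (P * Q) * (zeta_num (1 - z) / (- z)))"
    unfolding dup[symmetric] by (simp only: mult_ac)
  then have "a * (zeta_num z / (z - 1)) = c * (P * Q) * (zeta_num (1 - z) / (- z))"
    unfolding mult_cancel_left using abc by blast
  then have "(a * zeta_num z) / (z - 1) = (c * (P * Q) * zeta_num (1 - z)) / (- z)"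
    by (simp only: times_divide_eq_right)
  then have cross: "a * zeta_num z * (- z) = c * (P * Q) * zeta_num (1 - z) * (z - 1)"
    using z by (subst (asm) frac_eq_eq) auto
  have "- (z * a * zeta_num z) = a * zeta_num z * (- z)" by simp
  also note cross
  also have "c * (P * Q) * zeta_num (1 - z) * (z - 1) = - (c * (P * Q) * zeta_num (1 - z) * (1 - z))"
    by (simp add: right_diff_distrib)
  finally have "- (z * a * zeta_num z) = - (c * (P * Q) * zeta_num (1 - z) * (1 - z))" .
  then have e: "z * a * zeta_num z = c * (P * Q) * zeta_num (1 - z) * (1 - z)"
    by (rule neg_equal_iff_equal[THEN iffD1])
  have g: "Gamma (z / 2 + 1) = z / 2 * a" unfolding a_def by (rule Gamma_plus1) (rule nI)
  have "2 * rGamma ((1 - z) / 2) * zeta_num z = zeta_num z / (c / 2)"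
    unfolding rGamma_inverse_Gamma c_def[symmetric] by (simp add: inverse_eq_divide)
  also have "\<dots> = (zeta_num z * (z * a)) / (c / 2 * (z * a))"
    by (rule mult_divide_mult_cancel_right[symmetric]) (use z abc in simp)
  also have "zeta_num z * (z * a) = c * (P * Q * zeta_num (1 - z) * (1 - z))"
    using e by (simp only: mult_ac)
  also have "c / 2 * (z * a) = c * (z / 2 * a)" by simp
  also have "c * (P * Q * zeta_num (1 - z) * (1 - z)) / (c * (z / 2 * a)) = P * Q * zeta_num (1 - z) * (1 - z) / (z / 2 * a)"
    by (rule mult_divide_mult_cancel_left) (use abc in simp)
  also have "\<dots> = P * Q * rGamma (z / 2 + 1) * zeta_num (1 - z) * (1 - z)"
    unfolding rGamma_inverse_Gamma g divide_inverse[of _ "z / 2 * a"] by (simp only: mult_ac)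
  finally show ?thesis unfolding PQ z_def .
qed

text \<open>In this strip both \<open>s\<close> and \<open>1 - s\<close> have real part above -1, so
  both sides are holomorphic. They agree on a real interval, which has a limit point inside the
  strip.\<close>

lemma zeta_num_functional_strip:
  assumes "-1 < Re s" "Re s < 2"
  shows "2 * rGamma ((1 - s) / 2) * zeta_num s =
     of_real pi powr (s - 1 / 2) * rGamma (s / 2 + 1) * zeta_num (1 - s) * (1 - s)"
proof -
  define S where "S = {s. -1 < Re s} \<inter> {s. Re s < 2}"
  define f where "f s = 2 * rGamma ((1 - s) / 2) * zeta_num s -
     of_real pi powr (s - 1 / 2) * rGamma (s / 2 + 1) * zeta_num (1 - s) * (1 - s)" for s
  have "f s = 0"
  proof (rule analytic_continuation[of f S "complex_of_real ` {-1<..<0}" "- 1 / 2" s])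
    have "zeta_num holomorphic_on S"
      by (rule holomorphic_on_subset[OF zeta_num_holomorphic]) (auto simp: S_def)
    moreover have "(zeta_num \<circ> (\<lambda>s. 1 - s)) holomorphic_on S"
      by (rule holomorphic_on_compose_gen[OF _ zeta_num_holomorphic]) (auto simp: S_def intro!: holomorphic_intros)
    ultimately show "f holomorphic_on S"
      unfolding f_def o_def by (intro holomorphic_intros) auto
    show "open S" unfolding S_def by (intro open_Int open_halfspace_Re_gt open_halfspace_Re_lt)
    show "connected S" unfolding S_def
      by (intro convex_connected convex_Int convex_halfspace_Re_gt convex_halfspace_Re_lt)
    show "complex_of_real ` {-1<..<0} \<subseteq> S" by (auto simp: S_def)
    show "- 1 / 2 islimpt complex_of_real ` {-1<..<0}"
    proof -
      have "(- 1 / 2 :: real) islimpt {-1<..<0}" by (rule interior_limit_point) (auto simp: interior_open)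
      then have "complex_of_real (- 1 / 2) islimpt complex_of_real ` {-1<..<0}"
        by (rule islimpt_isCont_image) (simp_all add: eventually_at_filter complex_eq_iff)
      then show ?thesis by simp
    qed
    show "- 1 / 2 \<in> S" by (auto simp: S_def)
    show "s \<in> S" using assms by (auto simp: S_def)
    fix z assume "z \<in> complex_of_real ` {-1<..<0}"
    then show "f z = 0" using zeta_num_functional_real by (auto simp: f_def)
  qed
  then show ?thesis by (simp add: f_def)
qed

text \<open>The entire function \<open>(s - 1) * zeta(s)\<close>. The second branch is the
  functional equation solved for \<open>zeta_num s\<close>, with \<open>Gamma ((1 - s) / 2)\<close>
  inverting the reciprocal Gamma factor.\<close>

definition zeta_entire :: "complex \<Rightarrow> complex" where
  "zeta_entire s = (if s \<in> {s. Re s > -1} then zeta_num s else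
     of_real pi powr (s - 1 / 2) * rGamma (s / 2 + 1) * zeta_num (1 - s) * (1 - s) * Gamma ((1 - s) / 2) / 2)"

lemma zeta_entire_eq: "Re s > -1 \<Longrightarrow> zeta_entire s = zeta_num s"
  by (simp add: zeta_entire_def)

text \<open>The half planes \<open>Re s > -1\<close> and \<open>Re s < 0\<close> cover the plane.
  The second branch is holomorphic on the latter, where \<open>(1 - s) / 2\<close> avoids the poles
  of Gamma, and the strip identity makes the branches agree on the overlap.\<close>

lemma zeta_entire_holomorphic [holomorphic_intros]: "zeta_entire holomorphic_on A"
proof -
  let ?g = "\<lambda>s. complex_of_real pi powr (s - 1 / 2) * rGamma (s / 2 + 1) * zeta_num (1 - s) * (1 - s) * Gamma ((1 - s) / 2) / 2"
  have nI: "(1 - s) / 2 \<notin> \<int>\<^sub>\<le>\<^sub>0" if "Re s < 0" for s :: complex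
    using that by (auto simp: complex_eq_iff elim!: nonpos_Ints_cases)
  have "(\<lambda>s. if s \<in> {s. Re s > -1} then zeta_num s else ?g s) holomorphic_on ({s. Re s > -1} \<union> {s. Re s < 0})"
  proof (rule holomorphic_on_If_Un)
    show "zeta_num holomorphic_on {s. -1 < Re s}" by (rule zeta_num_holomorphic)
    have "(zeta_num \<circ> (\<lambda>s. 1 - s)) holomorphic_on {s. Re s < 0}"
      by (rule holomorphic_on_compose_gen[OF _ zeta_num_holomorphic]) (auto intro!: holomorphic_intros)
    moreover have "(Gamma \<circ> (\<lambda>s. (1 - s) / 2)) holomorphic_on {s. Re s < 0}"
      by (rule holomorphic_on_compose_gen[OF _ holomorphic_Gamma[of "- \<int>\<^sub>\<le>\<^sub>0"]])
         (use nI in \<open>auto intro!: holomorphic_intros\<close>)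
    ultimately show "?g holomorphic_on {s. Re s < 0}"
      unfolding o_def by (intro holomorphic_intros) (use nI in auto)
    fix s :: complex assume "s \<in> {s. -1 < Re s}" "s \<in> {s. Re s < 0}"
    then have s: "-1 < Re s" "Re s < 2" "Re s < 0" by auto
    have "?g s = (2 * rGamma ((1 - s) / 2) * zeta_num s) * Gamma ((1 - s) / 2) / 2"
      unfolding zeta_num_functional_strip[OF s(1,2)] ..
    also have "\<dots> = zeta_num s"
      using nI[OF s(3)] by (simp add: rGamma_inverse_Gamma Gamma_eq_zero_iff)
    finally show "zeta_num s = ?g s" by simp
  qed (auto intro: open_halfspace_Re_gt open_halfspace_Re_lt)
  then have "zeta_entire holomorphic_on ({s. Re s > -1} \<union> {s. Re s < 0})"
    by (simp only: zeta_entire_def[abs_def])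
  then show ?thesis by (rule holomorphic_on_subset) auto
qed

lemma zeta_entire_functional:
  "2 * rGamma ((1 - s) / 2) * zeta_entire s =
     of_real pi powr (s - 1 / 2) * rGamma (s / 2 + 1) * zeta_entire (1 - s) * (1 - s)"
proof -
  define S where "S = {s. -1 < Re s} \<inter> {s. Re s < 2}"
  define f where "f s = 2 * rGamma ((1 - s) / 2) * zeta_entire s" for s
  define g where "g s = of_real pi powr (s - 1 / 2) * rGamma (s / 2 + 1) * zeta_entire (1 - s) * (1 - s)" for s
  have "f s = g s"
  proof (rule analytic_continuation_open[of S UNIV f g s])
    show "open S" unfolding S_def by (intro open_Int open_halfspace_Re_gt open_halfspace_Re_lt)
    have "0 \<in> S" by (simp add: S_def)
    then show "S \<noteq> {}" by blast
    have "(zeta_entire \<circ> (\<lambda>s. 1 - s)) holomorphic_on UNIV"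
      by (intro holomorphic_on_compose holomorphic_intros)
    then show "g holomorphic_on UNIV"
      unfolding g_def o_def by (intro holomorphic_intros) auto
    show "f holomorphic_on UNIV" unfolding f_def by (intro holomorphic_intros) auto
    show "f s = g s" if "s \<in> S" for s
      using zeta_num_functional_strip[of s] that by (simp add: zeta_entire_eq f_def g_def S_def)
  qed auto
  then show ?thesis by (simp only: f_def g_def)
qed

text \<open>The uniqueness behind the definite description of \<open>riemann_zeta\<close>. The
  difference with removable singularities filled in vanishes on \<open>U\<close>, hence
  everywhere.\<close>

lemma nicely_meromorphic_on_UNIV_eqI:
  assumes f: "f nicely_meromorphic_on UNIV" and g: "g nicely_meromorphic_on UNIV"
    and U: "open U" "U \<noteq> {}" and eq: "\<And>z. z \<in> U \<Longrightarrow> f z = g z"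
  shows "f = g"
proof
  fix z
  define d where "d = (\<lambda>z. f z - g z)"
  have fm: "f meromorphic_on UNIV" and gm: "g meromorphic_on UNIV"
    using f g by (auto simp: nicely_meromorphic_on_def)
  then have dm: "d meromorphic_on UNIV" unfolding d_def by (intro meromorphic_intros)
  have nd: "remove_sings d nicely_meromorphic_on UNIV" by (rule remove_sings_nicely_meromorphic[OF dm])
  have U0: "remove_sings d w = 0" if "w \<in> U" for w
  proof (rule remove_sings_eqI)
    have "eventually (\<lambda>x. x \<in> U) (at w)" using U(1) that by (simp add: eventually_at_in_open')
    then have "eventually (\<lambda>x. d x = 0) (at w)" by eventually_elim (simp add: d_def eq)
    then show "d \<midarrow>w\<rightarrow> 0" by (rule tendsto_eventually)
  qed
  obtain u where u: "u \<in> U" using U by auto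
  have "remove_sings d constant_on UNIV"
    by (rule constant_on_extend_nicely_meromorphic_on[OF nd _ U(1)])
       (use U U0 in \<open>auto simp: constant_on_def\<close>)
  then have d0: "remove_sings d w = 0" for w using U0[OF u] by (auto simp: constant_on_def)
  have "eventually (\<lambda>w. remove_sings d w = d w) (at z)"
    by (rule eventually_remove_sings_eq_at)
       (rule meromorphic_on_isolated_singularity[OF meromorphic_on_subset[OF dm]], simp)
  then have ev: "eventually (\<lambda>w. f w = g w) (at z)"
    unfolding d0 by eventually_elim (simp add: d_def)
  then have pole: "is_pole f z \<longleftrightarrow> is_pole g z" by (intro is_pole_cong) auto
  \<comment> \<open>Agreement on a punctured neighbourhood has to be lifted to the point: at a
    common pole both functions take the dummy value 0, elsewhere both equal their common
    limit.\<close>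
  show "f z = g z"
  proof (cases "is_pole f z")
    case True
    then have "\<not> f \<midarrow>z\<rightarrow> f z" "\<not> g \<midarrow>z\<rightarrow> g z"
      using pole not_tendsto_and_filterlim_at_infinity[of "at z"] unfolding is_pole_def by auto
    then have "f z = 0" "g z = 0" using f g unfolding nicely_meromorphic_on_def by blast+
    then show ?thesis by simp
  next
    case False
    then have "f \<midarrow>z\<rightarrow> f z" "g \<midarrow>z\<rightarrow> g z" using f g pole by (auto simp: nicely_meromorphic_on_def)
    moreover have "f \<midarrow>z\<rightarrow> g z" using tendsto_cong[OF ev] \<open>g \<midarrow>z\<rightarrow> g z\<close> by blast
    ultimately show ?thesis by (intro LIM_unique[of f])
  qed
qed

section \<open>Identification of \<open>riemann_zeta\<close> with the quotient of
  \<open>zeta_entire s\<close> by \<open>s - 1\<close>\<close>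

lemma zeta_entire_1 [simp]: "zeta_entire 1 = 1"
  by (simp add: zeta_entire_eq)

lemma zeta_quotient_is_pole: "is_pole (\<lambda>s. zeta_entire s / (s - 1)) 1"
proof (rule is_pole_divide)
  show "isCont zeta_entire 1"
    by (rule holomorphic_on_imp_continuous_on[OF zeta_entire_holomorphic, THEN continuous_on_interior[of UNIV]]) auto
  show "filterlim (\<lambda>s. s - 1) (at 0) (at (1::complex))"
    by (auto intro!: filterlim_atI tendsto_eq_intros simp: eventually_at_filter)
qed simp

lemma zeta_quotient_analytic: "s \<noteq> 1 \<Longrightarrow> (\<lambda>s. zeta_entire s / (s - 1)) analytic_on {s}"
proof -
  assume "s \<noteq> 1"
  have "(\<lambda>s. zeta_entire s / (s - 1)) holomorphic_on - {1}" by (intro holomorphic_intros) auto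
  then show ?thesis using \<open>s \<noteq> 1\<close> by (intro holomorphic_on_imp_analytic_at[of _ "- {1}"]) auto
qed

text \<open>At the pole 1 the division by 0 yields 0, which is exactly the dummy value required of a
  nicely meromorphic function.\<close>

lemma zeta_quotient_nicely_meromorphic: "(\<lambda>s. zeta_entire s / (s - 1)) nicely_meromorphic_on UNIV"
proof (rule nicely_meromorphic_onI_open[of _ _ "{1}"])
  show "(\<lambda>s. zeta_entire s / (s - 1)) analytic_on UNIV - {1}"
    by (subst analytic_on_analytic_at) (auto intro: zeta_quotient_analytic)
  show "isolated_singularity_at (\<lambda>s. zeta_entire s / (s - 1)) s" for s
  proof (cases "s = 1")
    case True
    have "(\<lambda>s. zeta_entire s / (s - 1)) holomorphic_on UNIV - {1}" by (intro holomorphic_intros) auto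
    then show ?thesis unfolding True by (rule isolated_singularity_at_holomorphic) auto
  qed (intro isolated_singularity_at_analytic zeta_quotient_analytic)
qed (use zeta_quotient_is_pole in auto)

lemma riemann_zeta_eq: "riemann_zeta s = zeta_entire s / (s - 1)"
proof -
  let ?Z = "\<lambda>s. zeta_entire s / (s - 1)"
  have sums: "(\<lambda>n. of_nat (Suc n) powr (- s)) sums ?Z s" if "Re s > 1" for s
    using zeta_series_sums[OF that] that by (simp add: zeta_entire_eq)
  have "riemann_zeta = ?Z"
    unfolding riemann_zeta_def
  proof (rule the_equality)
    show "?Z nicely_meromorphic_on UNIV \<and> (\<forall>s. 1 < Re s \<longrightarrow> (\<lambda>n. of_nat (Suc n) powr - s) sums ?Z s)"
      using zeta_quotient_nicely_meromorphic sums by blast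
    fix f assume f: "f nicely_meromorphic_on UNIV \<and> (\<forall>s. 1 < Re s \<longrightarrow> (\<lambda>n. of_nat (Suc n) powr - s) sums f s)"
    show "f = ?Z"
    proof (rule nicely_meromorphic_on_UNIV_eqI[of _ _ "{s. Re s > 1}"])
      show "{s. Re s > 1} \<noteq> {}" by (auto intro!: exI[of _ 2])
      fix s assume "s \<in> {s. 1 < Re s}"
      then show "f s = ?Z s" using f sums sums_unique2 by blast
    qed (use f zeta_quotient_nicely_meromorphic in \<open>auto intro: open_halfspace_Re_gt\<close>)
  qed
  then show ?thesis by (rule fun_cong)
qed

text \<open>The series has positive terms and starts with 1. This rules out zeros at the points
  \<open>1 + 2 * n\<close>, the reflections of the trivial zeros.\<close>

lemma zeta_entire_real_nonzero:
  assumes "x > 1"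
  shows "zeta_entire (of_real x) \<noteq> 0"
proof
  assume 0: "zeta_entire (of_real x) = 0"
  have "(\<lambda>n. of_nat (Suc n) powr (- complex_of_real x)) sums 0"
    using zeta_series_sums[of "of_real x"] assms 0 by (simp add: zeta_entire_eq)
  also have "(\<lambda>n. of_nat (Suc n) powr (- of_real x)) = (\<lambda>n. complex_of_real (real (Suc n) powr (- x)))"
  proof
    fix n
    show "of_nat (Suc n) powr (- of_real x) = complex_of_real (real (Suc n) powr (- x))"
      using powr_of_real[of "real (Suc n)" "- x"] by (simp del: of_nat_Suc)
  qed
  finally have s: "(\<lambda>n. real (Suc n) powr (- x)) sums 0"
    using sums_of_real_iff[of _ 0] by (metis of_real_0)
  have "(\<Sum>n\<in>{0}. real (Suc n) powr (- x)) \<le> (\<Sum>n. real (Suc n) powr (- x))"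
    by (rule sum_le_suminf) (use s in \<open>auto simp: sums_iff\<close>)
  then show False using s by (simp add: sums_iff)
qed

lemma sphere_map_zeta_eq_0_iff: "sphere_map riemann_zeta s = Some 0 \<longleftrightarrow> zeta_entire s = 0"
proof -
  have eq: "riemann_zeta = (\<lambda>s. zeta_entire s / (s - 1))" by (rule ext) (rule riemann_zeta_eq)
  show ?thesis
  proof (cases "s = 1")
    case True
    then show ?thesis unfolding eq by (simp add: sphere_map_def zeta_quotient_is_pole)
  next
    case False
    then have a: "riemann_zeta analytic_on {s}" unfolding eq by (rule zeta_quotient_analytic)
    then have "\<not> is_pole riemann_zeta s" by (simp add: analytic_at_imp_no_pole)
    then show ?thesis using a False by (simp add: sphere_map_def riemann_zeta_eq)
  qed
qed

text \<open>In the functional equation the left side vanishes at \<open>s\<close>. On the right,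
  \<open>rGamma (s / 2 + 1)\<close> is zero only at trivial zeros, and \<open>1 - s\<close> is not 0
  because \<open>zeta_entire 1\<close> is 1, so \<open>zeta_entire (1 - s)\<close> must
  vanish.\<close>

lemma nontrivial_zeta_zero_symmetric:
  assumes "nontrivial_zeta_zero s"
  shows "nontrivial_zeta_zero (1 - s)"
proof -
  have s: "zeta_entire s = 0" "\<not> trivial_zeta_zero s"
    using assms by (auto simp: nontrivial_zeta_zero_def sphere_map_zeta_eq_0_iff)
  have "rGamma (s / 2 + 1) \<noteq> 0"
  proof
    assume "rGamma (s / 2 + 1) = 0"
    then obtain n where "s / 2 + 1 = - of_nat n" by (auto simp: rGamma_eq_zero_iff elim!: nonpos_Ints_cases')
    then have "2 * (s / 2 + 1) - 2 = 2 * (- of_nat n) - 2" by (simp only:)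
    then have "s = - 2 * of_nat (Suc n)" by simp
    then show False using s(2) unfolding trivial_zeta_zero_def by force
  qed
  moreover have "s \<noteq> 1" using s by auto
  ultimately have "zeta_entire (1 - s) = 0" using zeta_entire_functional[of s] s(1) by auto
  moreover have "\<not> trivial_zeta_zero (1 - s)"
  proof
    assume "trivial_zeta_zero (1 - s)"
    then obtain n :: nat where "1 - s = - 2 * of_nat n" "n \<ge> 1" by (auto simp: trivial_zeta_zero_def)
    then have "s = of_real (1 + 2 * real n)" "1 + 2 * real n > 1" by (auto simp: algebra_simps)
    then show False using zeta_entire_real_nonzero[of "1 + 2 * real n"] s(1) by simp
  qed
  ultimately show ?thesis by (simp add: nontrivial_zeta_zero_def sphere_map_zeta_eq_0_iff)
qed

section \<open>Fixed points of the relaxed Newton map\<close>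

lemma zeta_meromorphic: "riemann_zeta meromorphic_on A"
proof -
  have "riemann_zeta = (\<lambda>s. zeta_entire s / (s - 1))" by (rule ext) (rule riemann_zeta_eq)
  then have "riemann_zeta meromorphic_on UNIV"
    using zeta_quotient_nicely_meromorphic by (simp add: nicely_meromorphic_on_def)
  then show ?thesis by (rule meromorphic_on_subset) simp
qed

lemma zeta_analytic_at: "s \<noteq> 1 \<Longrightarrow> riemann_zeta analytic_on {s}"
  using zeta_quotient_analytic by (simp add: riemann_zeta_eq[abs_def])

lemma zeta_is_pole_1: "is_pole riemann_zeta 1"
  using zeta_quotient_is_pole by (simp add: riemann_zeta_eq[abs_def])

text \<open>A function meromorphic on the plane either vanishes off a discrete set or has isolated
  zeros; near a pole the former is impossible.\<close>

lemma eventually_nonzero_of_pole: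
  assumes "f meromorphic_on UNIV" "is_pole f w"
  shows "eventually (\<lambda>z. f z \<noteq> 0) (at s)"
proof -
  have "\<not> eventually (\<lambda>z. f z = 0) (at w)"
  proof
    assume "eventually (\<lambda>z. f z = 0) (at w)"
    then have "is_pole f w \<longleftrightarrow> is_pole (\<lambda>_. 0 :: complex) w" by (intro is_pole_cong) auto
    then show False using assms(2) by simp
  qed
  then show ?thesis
    using meromorphic_imp_constant_or_avoid[OF assms(1), of 0] by (auto simp: eventually_cosparse_open_eq)
qed

lemma zeta_deriv_eventually_nonzero: "eventually (\<lambda>z. deriv riemann_zeta z \<noteq> 0) (at s)"
proof (rule eventually_nonzero_of_pole)
  show "deriv riemann_zeta meromorphic_on UNIV" by (intro meromorphic_on_deriv zeta_meromorphic)
  show "is_pole (deriv riemann_zeta) 1"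
    by (rule is_pole_deriv[OF zeta_is_pole_1 meromorphic_on_isolated_singularity[OF zeta_meromorphic]])
qed

section \<open>Local form, fixed points and multipliers of the relaxed Newton map\<close>

definition nu_fun :: "complex \<Rightarrow> complex" where
  "nu_fun z = z - riemann_zeta z / (z * deriv riemann_zeta z)"

lemma nu_zeta_eq: "nu_zeta = sphere_map nu_fun"
  by (simp add: nu_zeta_def nu_fun_def[abs_def])

lemma nu_fun_meromorphic: "nu_fun meromorphic_on A"
  unfolding nu_fun_def[abs_def] by (intro meromorphic_intros zeta_meromorphic)

lemma log_deriv_local_form:
  assumes "isolated_singularity_at F \<alpha>" "not_essential F \<alpha>" "\<exists>\<^sub>F w in at \<alpha>. F w \<noteq> 0"
    and m: "zorder F \<alpha> \<noteq> 0" and \<alpha>: "\<alpha> \<noteq> 0"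
  obtains k where "k analytic_on {\<alpha>}" "k \<alpha> = 1 / (of_int (zorder F \<alpha>) * \<alpha>)"
    "eventually (\<lambda>z. F z / (z * deriv F z) = (z - \<alpha>) * k z) (at \<alpha>)"
proof -
  define n where "n = zorder F \<alpha>"
  define g where "g = zor_poly F \<alpha>"
  have n0: "n \<noteq> 0" using m by (simp add: n_def)
  obtain r where r: "r > 0" "g holomorphic_on cball \<alpha> r" and g\<alpha>: "g \<alpha> \<noteq> 0"
    and F: "\<And>w. w \<in> cball \<alpha> r - {\<alpha>} \<Longrightarrow> F w = g w * (w - \<alpha>) powi n \<and> g w \<noteq> 0"
    using zorder_exist[OF assms(1-3)] by (auto simp: n_def g_def)
  have gb: "g holomorphic_on ball \<alpha> r" by (rule holomorphic_on_subset[OF r(2) ball_subset_cball])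
  define D where "D z = of_int n * g z + (z - \<alpha>) * deriv g z" for z
  define k where "k z = g z / (z * D z)" for z
  have Dh: "D holomorphic_on ball \<alpha> r" unfolding D_def by (intro holomorphic_intros gb) auto
  have "D \<alpha> \<noteq> 0" using g\<alpha> n0 by (simp add: D_def)
  have an: "g analytic_on {\<alpha>}" "D analytic_on {\<alpha>}"
    using gb Dh r(1) by (auto intro!: holomorphic_on_imp_analytic_at)
  have k1: "k analytic_on {\<alpha>}"
    unfolding k_def using \<open>D \<alpha> \<noteq> 0\<close> \<alpha> an by (intro analytic_intros) auto
  have k2: "k \<alpha> = 1 / (of_int n * \<alpha>)"
    using g\<alpha> by (simp add: k_def D_def)
  have "eventually (\<lambda>z. z \<in> ball \<alpha> r - {\<alpha>}) (at \<alpha>)"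
    using r(1) by (intro eventually_at_in_open) auto
  then have k3: "eventually (\<lambda>z. F z / (z * deriv F z) = (z - \<alpha>) * k z) (at \<alpha>)"
  proof eventually_elim
    case (elim z)
    then have z: "z \<noteq> \<alpha>" "z \<in> ball \<alpha> r" by auto
    have gd: "(g has_field_derivative deriv g z) (at z)"
      by (rule holomorphic_derivI[OF gb open_ball z(2)])
    have "((\<lambda>w. w - \<alpha>) has_derivative (\<lambda>h. h)) (at z)" by (auto intro!: derivative_eq_intros)
    then have "((\<lambda>w. (w - \<alpha>) powi n) has_derivative (\<lambda>h. h * (of_int n * (z - \<alpha>) powi (n - 1)))) (at z)"
      using z by (intro has_derivative_power_int) auto
    then have "((\<lambda>w. (w - \<alpha>) powi n) has_field_derivative of_int n * (z - \<alpha>) powi (n - 1)) (at z)"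
      by (rule has_derivative_imp_has_field_derivative) simp
    from DERIV_mult[OF gd this] have "((\<lambda>w. g w * (w - \<alpha>) powi n) has_field_derivative
        (deriv g z * (z - \<alpha>) powi n + g z * (of_int n * (z - \<alpha>) powi (n - 1)))) (at z)"
      by (simp only: mult.commute[of _ "g z"])
    note d1 = this
    have "eventually (\<lambda>w. w \<in> ball \<alpha> r - {\<alpha>}) (nhds z)"
      using z by (intro eventually_nhds_in_open) auto
    then have "eventually (\<lambda>w. F w = g w * (w - \<alpha>) powi n) (nhds z)"
      by eventually_elim (use F in auto)
    then have "(F has_field_derivative (deriv g z * (z - \<alpha>) powi n + g z * (of_int n * (z - \<alpha>) powi (n - 1)))) (at z)"
      by (rule DERIV_cong_ev[OF refl _ refl, THEN iffD2, OF _ d1])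
    then have dF: "deriv F z = deriv g z * (z - \<alpha>) powi n + g z * (of_int n * (z - \<alpha>) powi (n - 1))"
      by (rule DERIV_imp_deriv)
    define P where "P = (z - \<alpha>) powi (n - 1)"
    have P0: "P \<noteq> 0" using z by (simp add: P_def)
    have p: "(z - \<alpha>) powi n = (z - \<alpha>) * P"
      using z power_int_add_1'[of "z - \<alpha>" "n - 1"] by (simp add: P_def)
    have dF': "deriv F z = P * D z"
      unfolding dF P_def[symmetric] p D_def by (simp add: algebra_simps)
    have "F z = g z * (z - \<alpha>) powi n" using F[of z] z by auto
    then have Fz: "F z = P * ((z - \<alpha>) * g z)" unfolding p by (simp only: mult_ac)
    have "F z / (z * deriv F z) = (P * ((z - \<alpha>) * g z)) / (P * (z * D z))"
      unfolding Fz dF' by (simp only: mult_ac)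
    also have "\<dots> = ((z - \<alpha>) * g z) / (z * D z)"
      by (rule mult_divide_mult_cancel_left[OF P0])
    finally show ?case by (simp add: k_def)
  qed
  show ?thesis by (rule that[OF k1 k2[unfolded n_def] k3])
qed

text \<open>Poles and filled-in values depend only on punctured neighbourhoods. Hence the agreement
  with \<open>e\<close> also gives the value at \<alpha>, whatever \<open>f\<close> itself does
  there.\<close>

lemma sphere_map_eventually_eq:
  assumes e: "e analytic_on {\<alpha>}" and ev: "eventually (\<lambda>z. f z = e z) (at \<alpha>)"
  shows "eventually (\<lambda>z. sphere_map f z = Some (e z)) (nhds \<alpha>)"
proof -
  obtain S where S: "open S" "\<alpha> \<in> S" "e holomorphic_on S" using e by (auto simp: analytic_at)
  obtain T where T: "open T" "\<alpha> \<in> T" "\<And>z. z \<in> T \<Longrightarrow> z \<noteq> \<alpha> \<Longrightarrow> f z = e z"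
    using ev by (auto simp: eventually_at_topological)
  have "sphere_map f z = Some (e z)" if z: "z \<in> S \<inter> T" for z
  proof -
    have "open (T - {\<alpha>})" using T by auto
    have fe: "eventually (\<lambda>w. f w = e w) (at z)"
    proof (cases "z = \<alpha>")
      case False
      then have "eventually (\<lambda>w. w \<in> T - {\<alpha>}) (at z)"
        using z T(1) by (intro eventually_at_in_open') auto
      then show ?thesis by eventually_elim (use T in auto)
    qed (use ev in simp)
    have ez: "e analytic_on {z}" using S z by (auto intro: holomorphic_on_imp_analytic_at)
    have "is_pole f z \<longleftrightarrow> is_pole e z" by (intro is_pole_cong fe refl)
    then have "\<not> is_pole f z" using ez by (simp add: analytic_at_imp_no_pole)
    moreover have "e \<midarrow>z\<rightarrow> e z" using ez analytic_at_imp_isCont isContD by blast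
    then have "f \<midarrow>z\<rightarrow> e z" using tendsto_cong[OF fe] by blast
    then have "remove_sings f z = e z" by (rule remove_sings_eqI)
    ultimately show ?thesis by (simp add: sphere_map_def)
  qed
  moreover have "eventually (\<lambda>z. z \<in> S \<inter> T) (nhds \<alpha>)" using S T by (intro eventually_nhds_in_open) auto
  ultimately show ?thesis by (auto elim: eventually_mono)
qed

text \<open>The trivial zeros start at -2, so a zero at 0 would be non-trivial and reflect to a zero
  at 1, where the value is 1.\<close>

lemma zeta_entire_0: "zeta_entire 0 \<noteq> 0"
proof
  assume "zeta_entire 0 = 0"
  then have "nontrivial_zeta_zero 0"
    by (simp add: nontrivial_zeta_zero_def sphere_map_zeta_eq_0_iff trivial_zeta_zero_def)
  then have "nontrivial_zeta_zero 1" using nontrivial_zeta_zero_symmetric[of 0] by simp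
  then show False by (simp add: nontrivial_zeta_zero_def sphere_map_zeta_eq_0_iff)
qed

lemma zorder_zeta_pos:
  assumes "zeta_entire \<alpha> = 0"
  shows "zorder riemann_zeta \<alpha> > 0"
proof -
  have "\<alpha> \<noteq> 1" using assms by auto
  have "riemann_zeta holomorphic_on - {1}"
    unfolding riemann_zeta_eq[abs_def] by (intro holomorphic_intros) auto
  moreover have "connected (- {1::complex})" by (rule connected_punctured_universe) simp
  moreover have "\<exists>w\<in>- {1}. riemann_zeta w \<noteq> 0"
    using zeta_entire_0 by (intro bexI[of _ 0]) (auto simp: riemann_zeta_eq)
  ultimately show ?thesis
    using zorder_exist_zero[of riemann_zeta "- {1}" \<alpha>] \<open>\<alpha> \<noteq> 1\<close> assms by (auto simp: riemann_zeta_eq)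
qed

lemma zorder_zeta_1: "zorder riemann_zeta 1 < 0"
  by (rule isolated_pole_imp_neg_zorder[OF meromorphic_on_isolated_singularity[OF zeta_meromorphic] zeta_is_pole_1])

text \<open>With \<open>e z = z - (z - \<alpha>) * k z\<close> the derivative at \<alpha> is
  \<open>1 - k \<alpha>\<close>. The representative is valid at \<alpha> as well, so fixed point,
  multiplier and absorbing disk can all be read off from it.\<close>

lemma nu_zeta_local_form:
  assumes "zeta_entire \<alpha> = 0 \<or> \<alpha> = 1"
  obtains e where "e analytic_on {\<alpha>}" "eventually (\<lambda>z. nu_zeta z = Some (e z)) (nhds \<alpha>)" "e \<alpha> = \<alpha>"
    "(e has_field_derivative (1 - 1 / (of_int (zorder riemann_zeta \<alpha>) * \<alpha>))) (at \<alpha>)"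
proof -
  have "\<alpha> \<noteq> 0" using assms zeta_entire_0 by auto
  moreover have "zorder riemann_zeta \<alpha> \<noteq> 0" using assms zorder_zeta_pos[of \<alpha>] zorder_zeta_1 by auto
  moreover have "\<exists>\<^sub>F w in at \<alpha>. riemann_zeta w \<noteq> 0"
    by (intro eventually_frequently eventually_nonzero_of_pole[OF zeta_meromorphic zeta_is_pole_1]) simp
  moreover have "isolated_singularity_at riemann_zeta \<alpha>" "not_essential riemann_zeta \<alpha>"
    using zeta_meromorphic[of "{\<alpha>}"] by (auto intro: meromorphic_on_isolated_singularity meromorphic_on_not_essential)
  ultimately obtain k where k: "k analytic_on {\<alpha>}" "k \<alpha> = 1 / (of_int (zorder riemann_zeta \<alpha>) * \<alpha>)"
    "eventually (\<lambda>z. riemann_zeta z / (z * deriv riemann_zeta z) = (z - \<alpha>) * k z) (at \<alpha>)"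
    using log_deriv_local_form[of riemann_zeta \<alpha>] by blast
  define e where "e z = z - (z - \<alpha>) * k z" for z
  have "e analytic_on {\<alpha>}" unfolding e_def by (intro analytic_intros k)
  moreover have "eventually (\<lambda>z. nu_fun z = e z) (at \<alpha>)"
    using k(3) by eventually_elim (simp add: nu_fun_def e_def)
  ultimately have "eventually (\<lambda>z. nu_zeta z = Some (e z)) (nhds \<alpha>)"
    unfolding nu_zeta_eq by (rule sphere_map_eventually_eq)
  moreover have "(k has_field_derivative deriv k \<alpha>) (at \<alpha>)"
    using k(1) analytic_on_imp_differentiable_at DERIV_deriv_iff_field_differentiable by blast
  then have "(e has_field_derivative (1 - k \<alpha>)) (at \<alpha>)"
    unfolding e_def by (auto intro!: derivative_eq_intros)
  ultimately show ?thesis using that[of e] \<open>e analytic_on {\<alpha>}\<close> k(2) by (simp add: e_def)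
qed

lemma nu_zeta_fixed_point_iff: "fixed_point nu_zeta \<alpha> \<longleftrightarrow> zeta_entire \<alpha> = 0 \<or> \<alpha> = 1"
proof
  assume "zeta_entire \<alpha> = 0 \<or> \<alpha> = 1"
  then show "fixed_point nu_zeta \<alpha>"
  proof (rule nu_zeta_local_form)
    fix e assume "eventually (\<lambda>z. nu_zeta z = Some (e z)) (nhds \<alpha>)" "e \<alpha> = \<alpha>"
    then show ?thesis using eventually_nhds_x_imp_x by (fastforce simp: fixed_point_def)
  qed
next
  assume fp: "fixed_point nu_zeta \<alpha>"
  show "zeta_entire \<alpha> = 0 \<or> \<alpha> = 1"
  proof (rule disjCI)
    assume "\<alpha> \<noteq> 1"
    have np: "\<not> is_pole nu_fun \<alpha>" and rs: "remove_sings nu_fun \<alpha> = \<alpha>"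
      using fp by (auto simp: fixed_point_def nu_zeta_eq sphere_map_def split: if_splits)
    have "not_essential nu_fun \<alpha>"
      using nu_fun_meromorphic[of "{\<alpha>}"] by (auto intro: meromorphic_on_not_essential)
    then obtain c where c: "nu_fun \<midarrow>\<alpha>\<rightarrow> c" using np by (auto simp: not_essential_def)
    then have "nu_fun \<midarrow>\<alpha>\<rightarrow> \<alpha>" using rs remove_sings_eqI by metis
    moreover have an: "riemann_zeta analytic_on {\<alpha>}" by (rule zeta_analytic_at) fact
    have "deriv riemann_zeta \<midarrow>\<alpha>\<rightarrow> deriv riemann_zeta \<alpha>"
      by (intro isContD analytic_at_imp_isCont analytic_deriv an)
    \<comment> \<open>Clearing the denominator recovers zeta near \<alpha>. At a fixed point the
      first factor tends to 0 while the second stays bounded, so zeta tends to 0.\<close>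
    ultimately have "(\<lambda>z. (z - nu_fun z) * (z * deriv riemann_zeta z)) \<midarrow>\<alpha>\<rightarrow> (\<alpha> - \<alpha>) * (\<alpha> * deriv riemann_zeta \<alpha>)"
      by (intro tendsto_intros)
    moreover have "eventually (\<lambda>z. (z - nu_fun z) * (z * deriv riemann_zeta z) = riemann_zeta z) (at \<alpha>)"
      using zeta_deriv_eventually_nonzero[of \<alpha>] eventually_neq_at_within[of 0 \<alpha>]
      by eventually_elim (simp add: nu_fun_def)
    ultimately have "riemann_zeta \<midarrow>\<alpha>\<rightarrow> (\<alpha> - \<alpha>) * (\<alpha> * deriv riemann_zeta \<alpha>)"
      by (rule Lim_transform_eventually)
    then have "riemann_zeta \<midarrow>\<alpha>\<rightarrow> 0" by simp
    moreover have "riemann_zeta \<midarrow>\<alpha>\<rightarrow> riemann_zeta \<alpha>" by (intro isContD analytic_at_imp_isCont an)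
    ultimately have "riemann_zeta \<alpha> = 0" by (rule LIM_unique[symmetric])
    then show "zeta_entire \<alpha> = 0" using \<open>\<alpha> \<noteq> 1\<close> by (simp add: riemann_zeta_eq)
  qed
qed

lemma nu_zeta_multiplier:
  assumes "fixed_point nu_zeta \<alpha>"
  shows "multiplier nu_zeta \<alpha> = 1 - 1 / (of_int (zorder riemann_zeta \<alpha>) * \<alpha>)"
proof -
  have "zeta_entire \<alpha> = 0 \<or> \<alpha> = 1" using assms by (simp add: nu_zeta_fixed_point_iff)
  then obtain e where e: "eventually (\<lambda>z. nu_zeta z = Some (e z)) (nhds \<alpha>)"
    "(e has_field_derivative (1 - 1 / (of_int (zorder riemann_zeta \<alpha>) * \<alpha>))) (at \<alpha>)"
    by (rule nu_zeta_local_form) blast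
  have "eventually (\<lambda>z. the (nu_zeta z) = e z) (nhds \<alpha>)" using e(1) by eventually_elim simp
  then have "multiplier nu_zeta \<alpha> = deriv e \<alpha>" unfolding multiplier_def by (rule deriv_cong_ev) simp
  then show ?thesis using e(2) by (simp add: DERIV_imp_deriv)
qed

text \<open>The norm is the ratio of the distances of \<open>w\<close> from 1 and from 0, and the
  perpendicular bisector of these points is the line \<open>Re w = 1/2\<close>.\<close>

lemma norm_one_minus_inverse:
  fixes w :: complex
  assumes "w \<noteq> 0"
  shows "norm (1 - 1 / w) < 1 \<longleftrightarrow> Re w > 1 / 2" "norm (1 - 1 / w) = 1 \<longleftrightarrow> Re w = 1 / 2"
proof -
  have "1 - 1 / w = (w - 1) / w" using assms by (simp add: field_simps)
  then have n: "norm (1 - 1 / w) = norm (w - 1) / norm w" by (simp add: norm_divide)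
  have sq: "(norm (w - 1))\<^sup>2 = (norm w)\<^sup>2 + (1 - 2 * Re w)"
    unfolding cmod_power2 by (simp add: power2_eq_square algebra_simps)
  have w: "norm w > 0" using assms by simp
  have "norm (1 - 1 / w) < 1 \<longleftrightarrow> norm (w - 1) < norm w" unfolding n using w by simp
  also have "\<dots> \<longleftrightarrow> (norm (w - 1))\<^sup>2 < (norm w)\<^sup>2"
  proof -
    have "(norm w)\<^sup>2 \<le> (norm (w - 1))\<^sup>2 \<longleftrightarrow> norm w \<le> norm (w - 1)"
      by (rule power_mono_iff) auto
    then show ?thesis by (simp only: not_le[symmetric])
  qed
  also have "\<dots> \<longleftrightarrow> Re w > 1 / 2" unfolding sq by auto
  finally show "norm (1 - 1 / w) < 1 \<longleftrightarrow> Re w > 1 / 2" .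
  have "norm (1 - 1 / w) = 1 \<longleftrightarrow> norm (w - 1) = norm w" unfolding n using w by (auto simp: divide_eq_1_iff)
  also have "\<dots> \<longleftrightarrow> (norm (w - 1))\<^sup>2 = (norm w)\<^sup>2"
    by (rule power2_eq_iff_nonneg[symmetric]) auto
  also have "\<dots> \<longleftrightarrow> Re w = 1 / 2" unfolding sq by auto
  finally show "norm (1 - 1 / w) = 1 \<longleftrightarrow> Re w = 1 / 2" .
qed

lemma attracting_fixed_point_nu_zeta_iff:
  "attracting_fixed_point nu_zeta \<alpha> \<longleftrightarrow>
     nontrivial_zeta_zero \<alpha> \<and> of_int (zorder riemann_zeta \<alpha>) * Re \<alpha> > 1 / 2"
proof -
  define m where "m = zorder riemann_zeta \<alpha>"
  have ratt: "attracting_fixed_point nu_zeta \<alpha> \<longleftrightarrow> (zeta_entire \<alpha> = 0 \<or> \<alpha> = 1) \<and> of_int m * Re \<alpha> > 1 / 2"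
  proof (cases "zeta_entire \<alpha> = 0 \<or> \<alpha> = 1")
    case True
    then have fp: "fixed_point nu_zeta \<alpha>" by (simp add: nu_zeta_fixed_point_iff)
    have "of_int m * \<alpha> \<noteq> 0" using True zeta_entire_0 zorder_zeta_pos[of \<alpha>] zorder_zeta_1 by (auto simp: m_def)
    from norm_one_minus_inverse(1)[OF this] show ?thesis
      using fp True by (simp add: attracting_fixed_point_def nu_zeta_multiplier m_def)
  qed (simp add: attracting_fixed_point_def nu_zeta_fixed_point_iff)
  show ?thesis
  proof (cases "\<alpha> = 1 \<or> (zeta_entire \<alpha> = 0 \<and> trivial_zeta_zero \<alpha>)")
    case True
    \<comment> \<open>The pole has negative order, and a trivial zero has positive order but
      negative real part; neither can be attracting.\<close>
    then have "of_int m * Re \<alpha> \<le> 0"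
    proof
      assume "\<alpha> = 1"
      then show ?thesis using zorder_zeta_1 by (simp add: m_def)
    next
      assume *: "zeta_entire \<alpha> = 0 \<and> trivial_zeta_zero \<alpha>"
      then have "m > 0" by (simp add: m_def zorder_zeta_pos)
      moreover have "Re \<alpha> \<le> 0" using * by (auto simp: trivial_zeta_zero_def)
      ultimately show ?thesis by (simp add: mult_nonneg_nonpos)
    qed
    then show ?thesis using ratt by (simp add: m_def)
  next
    case False
    then show ?thesis using ratt
      by (auto simp: nontrivial_zeta_zero_def sphere_map_zeta_eq_0_iff m_def)
  qed
qed

lemma indifferent_fixed_point_nu_zeta_iff:
  assumes "nontrivial_zeta_zero \<alpha>"
  shows "indifferent_fixed_point nu_zeta \<alpha> \<longleftrightarrow> of_int (zorder riemann_zeta \<alpha>) * Re \<alpha> = 1 / 2"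
proof -
  have z: "zeta_entire \<alpha> = 0"
    using assms by (simp add: nontrivial_zeta_zero_def sphere_map_zeta_eq_0_iff)
  then have fp: "fixed_point nu_zeta \<alpha>" by (simp add: nu_zeta_fixed_point_iff)
  have "of_int (zorder riemann_zeta \<alpha>) * \<alpha> \<noteq> 0" using z zeta_entire_0 zorder_zeta_pos[OF z] by auto
  from norm_one_minus_inverse(2)[OF this] show ?thesis
    using fp by (simp add: indifferent_fixed_point_def nu_zeta_multiplier)
qed

text \<open>Since \<open>s\<close> and \<open>1 - s\<close> are both zeros, \<open>m Re s \<le> 1/2\<close> at all of them forces \<open>m = 1\<close> and \<open>Re s = 1/2\<close>.\<close>

lemma nontrivial_zeros_on_critical_line:
  assumes "\<And>s. nontrivial_zeta_zero s \<Longrightarrow> of_int (zorder riemann_zeta s) * Re s \<le> 1 / 2"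
    and s: "nontrivial_zeta_zero s"
  shows "Re s = 1 / 2" "zorder riemann_zeta s = 1"
proof -
  have pos: "zorder riemann_zeta t \<ge> 1" if "nontrivial_zeta_zero t" for t
    using that zorder_zeta_pos[of t] by (simp add: nontrivial_zeta_zero_def sphere_map_zeta_eq_0_iff)
  have le: "Re t \<le> 1 / 2" if t: "nontrivial_zeta_zero t" for t
  proof (rule ccontr)
    assume "\<not> Re t \<le> 1 / 2"
    then have "Re t > 1 / 2" by simp
    moreover have "1 * Re t \<le> of_int (zorder riemann_zeta t) * Re t"
      using pos[OF t] \<open>Re t > 1 / 2\<close> by (intro mult_right_mono) auto
    ultimately show False using assms(1)[OF t] by simp
  qed
  show Re: "Re s = 1 / 2" using le[OF s] le[OF nontrivial_zeta_zero_symmetric[OF s]] by simp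
  have "of_int (zorder riemann_zeta s) \<le> (1::real)" using assms(1)[OF s] Re by simp
  then show "zorder riemann_zeta s = 1" using pos[OF s] by linarith
qed

section \<open>Absorbing disks\<close>

text \<open>A closed set of the sphere is either a compact subset of the plane or contains infinity.
  A closure inside the planar set \<open>D\<close> is of the first kind, so the condition becomes
  one about compact sets.\<close>

lemma maps_closure_into_iff:
  "maps_closure_into F D \<longleftrightarrow> (\<exists>K. compact K \<and> K \<subseteq> D \<and> F ` D \<subseteq> Some ` K)"
proof
  assume m: "maps_closure_into F D"
  let ?C = "riemann_sphere closure_of (F ` D)"
  have "topspace riemann_sphere = UNIV" by (auto simp: UNIV_option_conv)
  then have sub: "F ` D \<subseteq> ?C" by (intro closure_of_subset) simp
  have "closedin riemann_sphere ?C" by (rule closedin_closure_of)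
  then consider K where "compactin euclidean K" "?C = Some ` K"
    | U where "?C = topspace riemann_sphere - Some ` U"
    unfolding closedin_Alexandroff_compactification by blast
  then show "\<exists>K. compact K \<and> K \<subseteq> D \<and> F ` D \<subseteq> Some ` K"
  proof cases
    case 1
    then have "K \<subseteq> D" using m unfolding maps_closure_into_def by (auto simp: image_subset_iff image_iff)
    then show ?thesis using 1 sub by (intro exI[of _ K]) auto
  next
    case 2
    then have "None \<in> ?C" by auto
    then show ?thesis using m unfolding maps_closure_into_def by auto
  qed
next
  assume "\<exists>K. compact K \<and> K \<subseteq> D \<and> F ` D \<subseteq> Some ` K"
  then obtain K where K: "compact K" "K \<subseteq> D" "F ` D \<subseteq> Some ` K" by blast
  have "riemann_sphere closure_of (F ` D) \<subseteq> Some ` K"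
    by (rule closure_of_minimal[OF K(3)]) (use K in \<open>auto simp: compact_imp_closed\<close>)
  then show "maps_closure_into F D" using K(2) unfolding maps_closure_into_def by auto
qed

lemma compact_subset_ball_imp_cball:
  fixes K :: "complex set"
  assumes "compact K" "K \<subseteq> ball 0 1"
  obtains r where "0 < r" "r < 1" "K \<subseteq> cball 0 r"
proof (cases "K = {}")
  case False
  then obtain x where x: "x \<in> K" "\<And>y. y \<in> K \<Longrightarrow> norm y \<le> norm x"
    using continuous_attains_sup[OF assms(1), of norm] by (auto intro: continuous_intros)
  have "norm x < 1" using x assms by auto
  \<comment> \<open>The maximum with 1/2 keeps the radius positive even when \<open>K\<close> is
    just the origin.\<close>
  then show ?thesis using that[of "max (norm x) (1/2)"] x(2) by fastforce
qed (use that[of "1/2"] in auto)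

lemma self_map_attracting_fixed_point:
  fixes f :: "complex \<Rightarrow> complex"
  assumes D: "open D" "simply_connected D" "D \<noteq> {}" and f: "f holomorphic_on D"
    and K: "compact K" "K \<subseteq> D" "f ` D \<subseteq> K"
  obtains p where "p \<in> D" "f p = p" "norm (deriv f p) < 1"
proof (cases "D = UNIV")
  case True
  \<comment> \<open>The Riemann mapping theorem excludes the whole plane. There Liouville's theorem
    makes \<open>f\<close> constant, with multiplier 0.\<close>
  have "bounded (range f)" using K True compact_imp_bounded bounded_subset by blast
  then have "f constant_on UNIV" using Liouville_theorem f True by blast
  then obtain c where "f = (\<lambda>_. c)" by (auto simp: constant_on_def)
  then show ?thesis using that[of c] True by simp
next
  case False
  then obtain \<phi> \<psi> where hol: "\<phi> holomorphic_on D" "\<psi> holomorphic_on ball 0 1"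
    and \<phi>: "\<And>z. z \<in> D \<Longrightarrow> \<phi> z \<in> ball 0 1 \<and> \<psi> (\<phi> z) = z"
    and \<psi>: "\<And>z. z \<in> ball 0 1 \<Longrightarrow> \<psi> z \<in> D \<and> \<phi> (\<psi> z) = z"
    using Riemann_mapping_theorem[of D] D by metis
  have fD: "f z \<in> D" if "z \<in> D" for z using that K by blast
  have comp: "compact (g ` K)" if "g holomorphic_on D" for g :: "complex \<Rightarrow> complex"
    using that K holomorphic_on_imp_continuous_on holomorphic_on_subset compact_continuous_image by metis
  \<comment> \<open>In the disk model the map sends the unit disk into the image of
    \<open>K\<close>, hence a smaller closed ball into itself, where Brouwer's theorem
    applies.\<close>
  obtain p where p: "p \<in> D" "f p = p"
  proof -
    obtain r where r: "0 < r" "r < 1" "\<phi> ` K \<subseteq> cball 0 r"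
      using compact_subset_ball_imp_cball[OF comp[OF hol(1)]] \<phi> K by blast
    have cb: "cball 0 r \<subseteq> ball (0::complex) 1" using r by auto
    have "\<phi> \<circ> (f \<circ> \<psi>) holomorphic_on ball 0 1"
      by (intro holomorphic_on_compose_gen[OF _ hol(1)] holomorphic_on_compose_gen[OF _ f] hol) (use \<psi> fD in auto)
    then have "continuous_on (cball 0 r) (\<phi> \<circ> (f \<circ> \<psi>))"
      using cb holomorphic_on_imp_continuous_on continuous_on_subset by blast
    moreover have "\<phi> \<circ> (f \<circ> \<psi>) \<in> cball 0 r \<rightarrow> cball 0 r"
      using r(3) K(3) \<psi> cb by (auto simp: image_subset_iff subset_iff)
    ultimately obtain q where q: "q \<in> cball 0 r" "(\<phi> \<circ> (f \<circ> \<psi>)) q = q"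
      using brouwer[of "cball 0 r" "\<phi> \<circ> (f \<circ> \<psi>)"] r by auto
    have "\<psi> q \<in> D" using q(1) cb \<psi> by blast
    moreover have "f (\<psi> q) = \<psi> q" using q(2) \<phi>[OF fD[OF \<open>\<psi> q \<in> D\<close>]] by simp
    ultimately show ?thesis using that by blast
  qed
  \<comment> \<open>A disk automorphism moves the fixed point to the origin, as the Schwarz lemma
    requires.\<close>
  obtain A B where AB: "A (\<phi> p) = 0" "A holomorphic_on ball 0 1" "A ` ball 0 1 \<subseteq> ball 0 1"
     "B holomorphic_on ball 0 1" "B ` ball 0 1 \<subseteq> ball 0 1"
     "\<And>z. z \<in> ball 0 1 \<Longrightarrow> A (B z) = z" "\<And>z. z \<in> ball 0 1 \<Longrightarrow> B (A z) = z"
    using ball_biholomorphism_exists[of "\<phi> p"] \<phi> p by blast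
  define \<Phi> \<Psi> where "\<Phi> = A \<circ> \<phi>" and "\<Psi> = \<psi> \<circ> B"
  have \<Phi>h: "\<Phi> holomorphic_on D" unfolding \<Phi>_def
    by (rule holomorphic_on_compose_gen[OF hol(1) AB(2)]) (use \<phi> in auto)
  have \<Psi>h: "\<Psi> holomorphic_on ball 0 1" unfolding \<Psi>_def
    by (rule holomorphic_on_compose_gen[OF AB(4) hol(2)]) (use AB in auto)
  have \<Phi>: "\<Phi> z \<in> ball 0 1" if "z \<in> D" for z using that \<phi> AB(3) unfolding \<Phi>_def o_def by blast
  have \<Psi>: "\<Psi> z \<in> D" "\<Phi> (\<Psi> z) = z" if "z \<in> ball 0 1" for z
  proof -
    have "B z \<in> ball 0 1" using that AB(5) by blast
    then show "\<Psi> z \<in> D" "\<Phi> (\<Psi> z) = z" using \<psi> AB(6) that by (simp_all add: \<Phi>_def \<Psi>_def)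
  qed
  have "B 0 = \<phi> p" using AB(1,7) \<phi> p by metis
  then have \<Psi>0: "\<Psi> 0 = p" using \<phi> p by (simp add: \<Psi>_def)
  have \<Phi>p: "\<Phi> p = 0" by (simp add: \<Phi>_def AB)
  obtain r where r: "0 < r" "r < 1" "\<Phi> ` K \<subseteq> cball 0 r"
    using compact_subset_ball_imp_cball[OF comp[OF \<Phi>h]] \<Phi> K by blast
  \<comment> \<open>A radius strictly between \<open>r\<close> and 1: division by it still maps the
    disk into itself, so the Schwarz lemma bounds the multiplier by \<open>r'\<close>, which is less
    than 1.\<close>
  define r' where "r' = (1 + r) / 2"
  have r': "r < r'" "0 < r'" "r' < 1" using r by (auto simp: r'_def)
  define h where "h z = \<Phi> (f (\<Psi> z)) / of_real r'" for z
  have "(\<Phi> \<circ> (f \<circ> \<Psi>)) holomorphic_on ball 0 1"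
    by (intro holomorphic_on_compose_gen[OF _ \<Phi>h] holomorphic_on_compose_gen[OF _ f] \<Psi>h) (use \<Psi> fD in auto)
  then have hh: "h holomorphic_on ball 0 1" unfolding h_def o_def using r' by (intro holomorphic_intros) auto
  have "norm (deriv h 0) \<le> 1"
  proof (rule Schwarz_Lemma(2)[OF hh, of 0])
    show "h 0 = 0" by (simp add: h_def \<Psi>0 p \<Phi>p)
    fix z :: complex assume "norm z < 1"
    then have "f (\<Psi> z) \<in> K" using \<Psi>(1)[of z] K by auto
    then have "norm (\<Phi> (f (\<Psi> z))) \<le> r" using r(3) by auto
    then have "norm (\<Phi> (f (\<Psi> z))) < r'" using r' by simp
    then show "norm (h z) < 1" using r' by (simp add: h_def norm_divide)
  qed simp
  moreover have "deriv h 0 = deriv f p / of_real r'"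
  proof -
    have d\<Phi>: "(\<Phi> has_field_derivative deriv \<Phi> p) (at p)" using \<Phi>h D p by (auto intro: holomorphic_derivI)
    have df: "(f has_field_derivative deriv f p) (at p)" using f D p by (auto intro: holomorphic_derivI)
    have d\<Psi>: "(\<Psi> has_field_derivative deriv \<Psi> 0) (at 0)" using \<Psi>h by (auto intro: holomorphic_derivI)
    have "((\<lambda>z. \<Phi> (\<Psi> z)) has_field_derivative deriv \<Phi> p * deriv \<Psi> 0) (at 0)"
      using DERIV_chain2[of \<Phi> "deriv \<Phi> p" \<Psi> 0 "deriv \<Psi> 0" UNIV] d\<Phi> d\<Psi> \<Psi>0 by simp
    moreover have "eventually (\<lambda>z. \<Phi> (\<Psi> z) = z) (nhds 0)"
      using eventually_nhds_in_open[of "ball 0 1" "0::complex"] by (auto elim!: eventually_mono simp: \<Psi>)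
    then have "((\<lambda>z. \<Phi> (\<Psi> z)) has_field_derivative 1) (at 0)"
      by (intro DERIV_cong_ev[OF refl _ refl, THEN iffD2, OF _ DERIV_ident])
    \<comment> \<open>The derivatives of the two inverse charts cancel, so the conjugated map has
      the same multiplier as \<open>f\<close>.\<close>
    ultimately have one: "deriv \<Phi> p * deriv \<Psi> 0 = 1" by (rule DERIV_unique)
    have "((\<lambda>z. f (\<Psi> z)) has_field_derivative deriv f p * deriv \<Psi> 0) (at 0)"
      using DERIV_chain2[of f "deriv f p" \<Psi> 0 "deriv \<Psi> 0" UNIV] df d\<Psi> \<Psi>0 by simp
    then have "((\<lambda>z. \<Phi> (f (\<Psi> z))) has_field_derivative deriv \<Phi> p * (deriv f p * deriv \<Psi> 0)) (at 0)"
      using DERIV_chain2[of \<Phi> "deriv \<Phi> p" "\<lambda>z. f (\<Psi> z)" 0 _ UNIV] d\<Phi> \<Psi>0 p by simp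
    then have "(h has_field_derivative deriv \<Phi> p * (deriv f p * deriv \<Psi> 0) / of_real r') (at 0)"
      unfolding h_def by (rule DERIV_cdivide)
    then have "deriv h 0 = deriv \<Phi> p * (deriv f p * deriv \<Psi> 0) / of_real r'" by (rule DERIV_imp_deriv)
    also have "deriv \<Phi> p * (deriv f p * deriv \<Psi> 0) = deriv f p * (deriv \<Phi> p * deriv \<Psi> 0)" by (simp only: mult_ac)
    finally show ?thesis by (simp add: one)
  qed
  ultimately have "norm (deriv f p) \<le> r'" using r' by (simp add: norm_divide)
  then show ?thesis using that[of p] p r' by simp
qed

lemma attracting_imp_absorbing_disk:
  assumes F: "eventually (\<lambda>z. F z = Some (e z)) (nhds \<alpha>)" and "e \<alpha> = \<alpha>"
    and e: "(e has_field_derivative e') (at \<alpha>)" and e': "norm e' < 1"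
  shows "\<exists>D. topological_disk D \<and> maps_closure_into F D"
proof -
  \<comment> \<open>Half of the gap to 1, so that the linear approximation with this error contracts
    distances to \<alpha> by \<open>c < 1\<close> and maps a small ball into a concentric closed
    ball of \<open>c\<close> times the radius.\<close>
  define \<epsilon> where "\<epsilon> = (1 - norm e') / 2"
  have \<epsilon>: "\<epsilon> > 0" using e' by (simp add: \<epsilon>_def)
  define c where "c = norm e' + \<epsilon>"
  have c: "0 < c" "c < 1" using e' \<epsilon> by (auto simp: c_def \<epsilon>_def field_simps add_pos_nonneg)
  obtain d where d: "d > 0" "\<And>y. norm (y - \<alpha>) < d \<Longrightarrow> norm (e y - e \<alpha> - e' * (y - \<alpha>)) \<le> \<epsilon> * norm (y - \<alpha>)"
    using e \<epsilon> unfolding has_field_derivative_def has_derivative_at_alt by blast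
  obtain d' where d': "d' > 0" "\<And>z. dist z \<alpha> < d' \<Longrightarrow> F z = Some (e z)"
    using F unfolding eventually_nhds_metric by blast
  define r where "r = min d d'"
  have r: "r > 0" using d d' by (simp add: r_def)
  have "F z \<in> Some ` cball \<alpha> (c * r)" if "z \<in> ball \<alpha> r" for z
  proof -
    have z: "norm (z - \<alpha>) < d" "dist z \<alpha> < d'" "norm (z - \<alpha>) < r"
      using that by (auto simp: r_def dist_norm norm_minus_commute)
    have "norm (e z - \<alpha>) = norm ((e z - e \<alpha> - e' * (z - \<alpha>)) + e' * (z - \<alpha>))" by (simp add: \<open>e \<alpha> = \<alpha>\<close>)
    also have "\<dots> \<le> norm (e z - e \<alpha> - e' * (z - \<alpha>)) + norm (e' * (z - \<alpha>))" by (rule norm_triangle_ineq)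
    also have "\<dots> \<le> \<epsilon> * norm (z - \<alpha>) + norm e' * norm (z - \<alpha>)"
      using d(2)[OF z(1)] by (simp add: norm_mult)
    also have "\<dots> = c * norm (z - \<alpha>)" by (simp add: c_def algebra_simps)
    also have "\<dots> \<le> c * r" using z c by (intro mult_left_mono) auto
    finally have "e z \<in> cball \<alpha> (c * r)" by (simp add: dist_norm norm_minus_commute)
    then show ?thesis using d'(2)[OF z(2)] by simp
  qed
  moreover have "cball \<alpha> (c * r) \<subseteq> ball \<alpha> r" using r c by (auto simp: cball_subset_ball_iff)
  ultimately have "maps_closure_into F (ball \<alpha> r)"
    unfolding maps_closure_into_iff by (intro exI[of _ "cball \<alpha> (c * r)"]) auto
  moreover have "topological_disk (ball \<alpha> r)"
    using r homeomorphic_balls(1)[of r 1 \<alpha> 0] by (simp add: topological_disk_def)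
  ultimately show ?thesis by blast
qed

text \<open>The image of \<open>D\<close> consists of finite points, so there are no poles in
  \<open>D\<close> and the filled-in function is a holomorphic self-map of \<open>D\<close> with
  image in a compact set.\<close>

lemma absorbing_disk_imp_attracting:
  assumes f: "f meromorphic_on UNIV" and D: "topological_disk D" "maps_closure_into (sphere_map f) D"
  shows "\<exists>p. attracting_fixed_point (sphere_map f) p"
proof -
  obtain K where K: "compact K" "K \<subseteq> D" "sphere_map f ` D \<subseteq> Some ` K"
    using D(2) by (auto simp: maps_closure_into_iff)
  have "open D" "D homeomorphic ball (0::complex) 1" using D(1) by (auto simp: topological_disk_def)
  then have D': "open D" "simply_connected D" "D \<noteq> {}"
    using homeomorphic_simply_connected_eq convex_imp_simply_connected[OF convex_ball] by (auto simp: homeomorphic_empty)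
  define F where "F = remove_sings f"
  have nF: "F nicely_meromorphic_on UNIV" unfolding F_def by (rule remove_sings_nicely_meromorphic[OF f])
  have iso: "isolated_singularity_at f z" for z
    by (rule meromorphic_on_isolated_singularity[OF meromorphic_on_subset[OF f]]) simp
  have np: "\<not> is_pole f z" if "z \<in> D" for z
    using K(3) that by (auto simp: sphere_map_def image_subset_iff split: if_splits)
  have eq: "sphere_map f z = Some (F z)" if "z \<in> D" for z
    using np[OF that] by (simp add: sphere_map_def F_def)
  have "F analytic_on {z}" if "z \<in> D" for z
    using nicely_meromorphic_on_imp_analytic_at[OF nF, of z] np[OF that] iso by (simp add: F_def)
  then have Fh: "F holomorphic_on D" using analytic_imp_holomorphic analytic_on_analytic_at by blast
  have "F ` D \<subseteq> K" using K(3) eq by (auto simp: image_subset_iff)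
  then obtain p where p: "p \<in> D" "F p = p" "norm (deriv F p) < 1"
    using self_map_attracting_fixed_point[OF D' Fh K(1,2)] by blast
  have "eventually (\<lambda>z. the (sphere_map f z) = F z) (nhds p)"
    using eventually_nhds_in_open[OF D'(1) p(1)] by eventually_elim (simp add: eq)
  then have "multiplier (sphere_map f) p = deriv F p"
    unfolding multiplier_def by (rule deriv_cong_ev) simp
  then show ?thesis using p eq[OF p(1)] by (auto simp: attracting_fixed_point_def fixed_point_def)
qed

section \<open>Conjugation by homeomorphisms of the sphere\<close>

lemma topspace_riemann_sphere: "topspace riemann_sphere = UNIV"
  by (auto simp: UNIV_option_conv)

lemma sphere_homeo_inv:
  assumes "sphere_homeo_fixing_infinity h"
  shows "bij h" "sphere_homeo_fixing_infinity (inv h)"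
proof -
  obtain g where g: "homeomorphic_maps riemann_sphere riemann_sphere h g"
    using assms homeomorphic_map_maps unfolding sphere_homeo_fixing_infinity_def by blast
  then have "g (h x) = x" "h (g x) = x" for x
    unfolding homeomorphic_maps_def topspace_riemann_sphere by blast+
  then show "bij h" by (metis bij_iff)
  have "inv h = g" using \<open>\<And>x. g (h x) = x\<close> \<open>\<And>x. h (g x) = x\<close> by (intro inv_equality)
  moreover have "homeomorphic_map riemann_sphere riemann_sphere g"
    using g homeomorphic_maps_sym homeomorphic_map_maps by blast
  moreover have "g None = None"
    using assms \<open>\<And>x. g (h x) = x\<close> unfolding sphere_homeo_fixing_infinity_def by metis
  ultimately show "sphere_homeo_fixing_infinity (inv h)" by (simp add: sphere_homeo_fixing_infinity_def)
qed

lemma sphere_homeo_Some: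
  assumes "sphere_homeo_fixing_infinity h"
  shows "h (Some z) = Some (the (h (Some z)))"
proof -
  have "inj h" using sphere_homeo_inv[OF assms] by (simp add: bij_is_inj)
  then have "h (Some z) \<noteq> h None" by (metis inj_eq option.distinct(1))
  then show ?thesis using assms by (simp add: sphere_homeo_fixing_infinity_def)
qed

lemma sphere_homeo_continuous:
  assumes "sphere_homeo_fixing_infinity h"
  shows "continuous_on A (\<lambda>z. the (h (Some z)))"
proof (rule continuous_on_subset)
  show "continuous_on UNIV (\<lambda>z. the (h (Some z)))"
    unfolding continuous_on_open_vimage[OF open_UNIV]
  proof (intro allI impI)
    fix U :: "complex set" assume "open U"
    have "continuous_map riemann_sphere riemann_sphere h"
      using assms homeomorphic_imp_continuous_map by (auto simp: sphere_homeo_fixing_infinity_def)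
    then have "continuous_map euclidean riemann_sphere (h \<circ> Some)"
      using continuous_map_Some continuous_map_compose by blast
    moreover have "openin riemann_sphere (Some ` U)" using \<open>open U\<close> by simp
    ultimately have "openin euclidean {z \<in> topspace euclidean. (h \<circ> Some) z \<in> Some ` U}"
      by (rule openin_continuous_map_preimage)
    moreover have "h (Some z) \<in> Some ` U \<longleftrightarrow> the (h (Some z)) \<in> U" for z
      by (subst sphere_homeo_Some[OF assms]) auto
    ultimately show "open ((\<lambda>z. the (h (Some z))) -` U \<inter> UNIV)" by (simp add: vimage_def)
  qed
qed simp

text \<open>As \<open>h\<close> fixes infinity, it restricts to a homeomorphism \<open>g\<close> of
  the plane. Its inverse \<open>g'\<close> carries the disk and the compact set \<open>K\<close>
  back to an absorbing disk for \<open>F\<close>.\<close>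

lemma sphere_conjugate_absorbing_disk:
  assumes h: "sphere_homeo_fixing_infinity h"
    and D: "topological_disk D" "maps_closure_into (sphere_conjugate h F) D"
  shows "\<exists>D. topological_disk D \<and> maps_closure_into F D"
proof -
  define g where "g z = the (h (Some z))" for z
  define g' where "g' z = the (inv h (Some z))" for z
  have bij: "bij h" and hi: "sphere_homeo_fixing_infinity (inv h)" using sphere_homeo_inv[OF h] by auto
  have hg: "h (Some z) = Some (g z)" for z unfolding g_def by (rule sphere_homeo_Some[OF h])
  have hg': "inv h (Some z) = Some (g' z)" for z unfolding g'_def by (rule sphere_homeo_Some[OF hi])
  have g'g: "g' (g z) = z" for z
    using hg'[of "g z"] inv_f_f[OF bij_is_inj[OF bij], of "Some z"] by (simp add: hg)
  have gg': "g (g' z) = z" for z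
    using hg[of "g' z"] surj_f_inv_f[OF bij_is_surj[OF bij], of "Some z"] by (simp add: hg')
  have cont: "continuous_on A g" "continuous_on A g'" for A
    unfolding g_def g'_def by (intro sphere_homeo_continuous h hi)+
  obtain K where K: "compact K" "K \<subseteq> D" "sphere_conjugate h F ` D \<subseteq> Some ` K"
    using D(2) by (auto simp: maps_closure_into_iff)
  have D': "open D" "D homeomorphic ball (0::complex) 1" using D(1) by (auto simp: topological_disk_def)
  \<comment> \<open>Seen as a preimage under the continuous \<open>g\<close>, the new disk is
    open.\<close>
  have vim: "g' ` D = g -` D" 
  proof (intro equalityI subsetI)
    fix w assume "w \<in> g -` D"
    then have "g' (g w) \<in> g' ` D" by blast
    then show "w \<in> g' ` D" by (simp add: g'g)
  qed (auto simp: gg')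
  have "open (g -` D)" using cont(1)[of UNIV] D'(1) by (intro open_vimage) auto
  moreover have "homeomorphism (g' ` D) D g g'"
    using cont by (auto simp: homeomorphism_def g'g gg' image_image)
  then have "g' ` D homeomorphic ball (0::complex) 1"
    using D'(2) homeomorphic_def homeomorphic_trans by blast
  ultimately have "topological_disk (g' ` D)" by (simp add: topological_disk_def vim)
  moreover have "maps_closure_into F (g' ` D)"
    unfolding maps_closure_into_iff
  proof (intro exI conjI)
    show "compact (g' ` K)" by (rule compact_continuous_image[OF cont(2) K(1)])
    show "g' ` K \<subseteq> g' ` D" using K(2) by blast
    show "F ` g' ` D \<subseteq> Some ` g' ` K"
    proof clarify
      fix w assume "w \<in> D"
      then have "sphere_conjugate h F w \<in> Some ` K" using K(3) by blast
      then obtain k where k: "k \<in> K" "h (F (g' w)) = Some k"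
        by (auto simp: sphere_conjugate_def g'_def)
      then have "F (g' w) = inv h (Some k)" using inv_f_f[OF bij_is_inj[OF bij], of "F (g' w)"] by simp
      then show "F (g' w) \<in> Some ` g' ` K" using k(1) hg' by simp
    qed
  qed
  ultimately show ?thesis by blast
qed

lemma sphere_conjugate_id:
  "sphere_homeo_fixing_infinity id" "sphere_conjugate id F = F"
  by (auto simp: sphere_homeo_fixing_infinity_def sphere_conjugate_def[abs_def] inv_id)

lemma absorbing_disk_nu_zeta_iff:
  "(\<exists>D. topological_disk D \<and> maps_closure_into nu_zeta D) \<longleftrightarrow> (\<exists>\<alpha>. attracting_fixed_point nu_zeta \<alpha>)"
proof
  assume "\<exists>D. topological_disk D \<and> maps_closure_into nu_zeta D"
  then show "\<exists>\<alpha>. attracting_fixed_point nu_zeta \<alpha>"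
    using absorbing_disk_imp_attracting[OF nu_fun_meromorphic] unfolding nu_zeta_eq by blast
next
  assume "\<exists>\<alpha>. attracting_fixed_point nu_zeta \<alpha>"
  then obtain \<alpha> where \<alpha>: "fixed_point nu_zeta \<alpha>" "norm (multiplier nu_zeta \<alpha>) < 1"
    by (auto simp: attracting_fixed_point_def)
  then have "zeta_entire \<alpha> = 0 \<or> \<alpha> = 1" by (simp add: nu_zeta_fixed_point_iff)
  then show "\<exists>D. topological_disk D \<and> maps_closure_into nu_zeta D"
  proof (rule nu_zeta_local_form)
    fix e assume "eventually (\<lambda>z. nu_zeta z = Some (e z)) (nhds \<alpha>)" "e \<alpha> = \<alpha>"
      "(e has_field_derivative (1 - 1 / (of_int (zorder riemann_zeta \<alpha>) * \<alpha>))) (at \<alpha>)"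
    then show ?thesis
      by (rule attracting_imp_absorbing_disk) (use \<alpha> nu_zeta_multiplier in simp)
  qed
qed

text \<open>Near a non-trivial zero zeta is analytic and not identically 0, so \<open>zorder\<close>
  is the multiplicity there and the value 1 expresses simplicity.\<close>

theorem theorem10:
  shows
    "(((\<forall>s. nontrivial_zeta_zero s \<longrightarrow> Re s = 1 / 2) \<and>
       (\<forall>s. nontrivial_zeta_zero s \<longrightarrow> zorder riemann_zeta s = 1))
      \<longleftrightarrow> (\<forall>s. nontrivial_zeta_zero s \<longrightarrow> indifferent_fixed_point nu_zeta s))
   \<and> ((\<forall>s. nontrivial_zeta_zero s \<longrightarrow> indifferent_fixed_point nu_zeta s)
      \<longleftrightarrow> \<not> (\<exists>\<alpha>. attracting_fixed_point nu_zeta \<alpha>))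
   \<and> (\<not> (\<exists>\<alpha>. attracting_fixed_point nu_zeta \<alpha>)
      \<longleftrightarrow> \<not> (\<exists>D. topological_disk D \<and> maps_closure_into nu_zeta D))
   \<and> (\<not> (\<exists>D. topological_disk D \<and> maps_closure_into nu_zeta D)
      \<longleftrightarrow> (\<forall>h. sphere_homeo_fixing_infinity h \<longrightarrow>
            \<not> (\<exists>D. topological_disk D \<and> maps_closure_into (sphere_conjugate h nu_zeta) D)))"
proof -
  let ?a = "(\<forall>s. nontrivial_zeta_zero s \<longrightarrow> Re s = 1 / 2) \<and>
      (\<forall>s. nontrivial_zeta_zero s \<longrightarrow> zorder riemann_zeta s = 1)"
  let ?b = "\<forall>s. nontrivial_zeta_zero s \<longrightarrow> indifferent_fixed_point nu_zeta s"
  let ?c = "\<not> (\<exists>\<alpha>. attracting_fixed_point nu_zeta \<alpha>)"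
  let ?d = "\<lambda>F. \<exists>D. topological_disk D \<and> maps_closure_into F D"
  have ab: "?a \<Longrightarrow> ?b" by (simp add: indifferent_fixed_point_nu_zeta_iff)
  have bc: "?b \<Longrightarrow> ?c"
    using attracting_fixed_point_nu_zeta_iff indifferent_fixed_point_nu_zeta_iff by (metis less_irrefl)
  have ca: "?a" if ?c
  proof -
    have "of_int (zorder riemann_zeta s) * Re s \<le> 1 / 2" if "nontrivial_zeta_zero s" for s
      using \<open>?c\<close> that by (auto simp: attracting_fixed_point_nu_zeta_iff not_less)
    from nontrivial_zeros_on_critical_line[OF this] show ?thesis by blast
  qed
  have cd: "?c \<longleftrightarrow> \<not> ?d nu_zeta" by (simp only: absorbing_disk_nu_zeta_iff)
  have de: "\<not> ?d nu_zeta \<longleftrightarrow> (\<forall>h. sphere_homeo_fixing_infinity h \<longrightarrow> \<not> ?d (sphere_conjugate h nu_zeta))"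
  proof
    assume "\<not> ?d nu_zeta"
    then show "\<forall>h. sphere_homeo_fixing_infinity h \<longrightarrow> \<not> ?d (sphere_conjugate h nu_zeta)"
      using sphere_conjugate_absorbing_disk[of _ _ nu_zeta] by blast
  next
    assume "\<forall>h. sphere_homeo_fixing_infinity h \<longrightarrow> \<not> ?d (sphere_conjugate h nu_zeta)"
    \<comment> \<open>The identity is an admissible \<open>h\<close> and gives back
      \<open>nu_zeta\<close> itself.\<close>
    from this[rule_format, OF sphere_conjugate_id(1)] show "\<not> ?d nu_zeta"
      unfolding sphere_conjugate_id(2) .
  qed
  have "?a \<longleftrightarrow> ?b" "?b \<longleftrightarrow> ?c" using ab bc ca by satx+
  with cd de show ?thesis by (intro conjI)
qed

end
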